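(* For every finite set $S$, the poset $\mathrm{NS}(S)$ is a geometric lattice, and hence is Cohen--Macaulay. Its only non-zero cohomology group is $h^{|S|-1}(\mathrm{NS}(S))$, which is free of rank $|S|-1$.
   Context: All finite sets are assumed to be non-empty. $\mathrm{NS}(S)$ is the non-singleton boolean poset: the poset of partitions of $S$ with at most one block of cardinality $\ge2$, where $\alpha\le\beta$ iff $\alpha$ is obtained by merging blocks of $\beta$. (For $|S|\ge2$ it is isomorphic to the poset of subsets of $S$ that are not singletons, ordered by reverse inclusion.) Coefficients are in a commutative ring with unit $\mathbb{K}$. For a finite poset $P$, $c^n(P)$ is the free $\mathbb{K}$-module on symbols $[x_0<\cdots<x_n]$ for chains with $x_0$ minimal and $x_n$ maximal in $P$, with $d[x_0<\cdots<x_n]=\sum_{i=1}^n(-1)^i\sum_{x_{i-1}<y<x_i}[\cdots<x_{i-1}<y<x_i<\cdots]$; $h^\bullet(P)$ is its cohomology and $h_\bullet(P)$ the homology of the dual chain complex. A graded poset $P$ is Cohen--Macaulay (over $\mathbb{K}$) if for all $x\le y$ in $P$, $h_n([x,y])=0$ for $n$ different from the rank of $[x,y]$.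
   Formalization: For |S| = 1 the poset is a point and its only cohomology group h^0 = K is free of rank 1, not |S|-1 = 0; so rank |S|-1 is proved for |S| ≥ 2 and rank 1 for |S| = 1. The ring K is taken to be non-zero. *)

theory Defs
  imports
    "HOL-Algebra.Lattice"
    "HOL-Library.Disjoint_Sets"
    "HOL-Library.FuncSet"
    "HOL-Library.Function_Algebras"
    "HOL-Library.Poly_Mapping"
begin

section \<open>Posets\<close>

definition interval :: "'v gorder \<Rightarrow> 'v \<Rightarrow> 'v \<Rightarrow> 'v gorder" where
  "interval P x y = P\<lparr>carrier := \<lbrace>x..y\<rbrace>\<^bsub>P\<^esub>\<rparr>"

definition minimal :: "'v gorder \<Rightarrow> 'v \<Rightarrow> bool" where
  "minimal P x \<longleftrightarrow> x \<in> carrier P \<and> (\<forall>y\<in>carrier P. y \<sqsubseteq>\<^bsub>P\<^esub> x \<longrightarrow> y = x)"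

definition maximal :: "'v gorder \<Rightarrow> 'v \<Rightarrow> bool" where
  "maximal P x \<longleftrightarrow> x \<in> carrier P \<and> (\<forall>y\<in>carrier P. x \<sqsubseteq>\<^bsub>P\<^esub> y \<longrightarrow> y = x)"

text \<open>\<open>covered P x y\<close> means that \<open>y\<close> covers \<open>x\<close>.\<close>

definition covered :: "'v gorder \<Rightarrow> 'v \<Rightarrow> 'v \<Rightarrow> bool" where
  "covered P x y \<longleftrightarrow> x \<in> carrier P \<and> y \<in> carrier P \<and> x \<sqsubset>\<^bsub>P\<^esub> y
     \<and> \<not> (\<exists>z\<in>carrier P. x \<sqsubset>\<^bsub>P\<^esub> z \<and> z \<sqsubset>\<^bsub>P\<^esub> y)"

text \<open>Graded: for all \<open>x \<le> y\<close>, all saturated chains from \<open>x\<close> to \<open>y\<close>, that is, all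
  maximal chains of \<open>[x,y]\<close>, have the same length.\<close>

definition graded_poset :: "'v gorder \<Rightarrow> bool" where
  "graded_poset P \<longleftrightarrow> partial_order P \<and> finite (carrier P) \<and>
     (\<forall>xs ys. xs \<noteq> [] \<and> ys \<noteq> [] \<and> successively (covered P) xs \<and> successively (covered P) ys
        \<and> hd xs = hd ys \<and> last xs = last ys \<longrightarrow> length xs = length ys)"

text \<open>A finite lattice is geometric if it is atomistic and (upper) semimodular.
  The empty join is the least element.\<close>

definition atom :: "'v gorder \<Rightarrow> 'v \<Rightarrow> bool" where
  "atom L a \<longleftrightarrow> covered L \<bottom>\<^bsub>L\<^esub> a"

definition atomistic :: "'v gorder \<Rightarrow> bool" where
  "atomistic L \<longleftrightarrow> (\<forall>x\<in>carrier L. \<exists>A. (\<forall>a\<in>A. atom L a) \<and> is_lub L x A)"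

definition semimodular :: "'v gorder \<Rightarrow> bool" where
  "semimodular L \<longleftrightarrow> (\<forall>x\<in>carrier L. \<forall>y\<in>carrier L.
     covered L (x \<sqinter>\<^bsub>L\<^esub> y) x \<longrightarrow> covered L y (x \<squnion>\<^bsub>L\<^esub> y))"

definition geometric_lattice :: "'v gorder \<Rightarrow> bool" where
  "geometric_lattice L \<longleftrightarrow> lattice L \<and> finite (carrier L) \<and> carrier L \<noteq> {}
     \<and> atomistic L \<and> semimodular L"


section \<open>Subquotients\<close>

definition mod_rel :: "'m::ab_group_add set \<Rightarrow> 'm set \<Rightarrow> ('m \<times> 'm) set" where
  "mod_rel Z B = {(u, v). u \<in> Z \<and> v \<in> Z \<and> u - v \<in> B}"

text \<open>The set of cosets \<open>Z / B\<close>. It is the zero module iff it has exactly one element.\<close>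

definition subquotient :: "'m::ab_group_add set \<Rightarrow> 'm set \<Rightarrow> 'm set set" where
  "subquotient Z B = Z // mod_rel Z B"

text \<open>\<open>Z / B\<close>, with the module structure induced from \<open>Z\<close>, has a basis
  \<open>[e 0], \<dots>, [e (r - 1)]\<close>: the map \<open>c \<mapsto> \<Sum>i<r. c i \<cdot> [e i]\<close> from coefficient vectors to
  \<open>Z / B\<close> is bijective.\<close>

definition subquotient_free_of_rank ::
    "('k::comm_ring_1 \<Rightarrow> 'm::ab_group_add \<Rightarrow> 'm) \<Rightarrow> 'm set \<Rightarrow> 'm set \<Rightarrow> nat \<Rightarrow> bool" where
  "subquotient_free_of_rank scale Z B r \<longleftrightarrow>
     (\<exists>e. (\<forall>i<r. e i \<in> Z) \<and>
        bij_betw (\<lambda>c. mod_rel Z B `` {\<Sum>i<r. scale (c i) (e i)})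
          ({..<r} \<rightarrow>\<^sub>E UNIV) (subquotient Z B))"


section \<open>The cochain complex of a poset\<close>

text \<open>The chain \<open>x\<^sub>0 < \<dots> < x\<^sub>n\<close> is the list of its elements, of length \<open>n + 1\<close>. The free module
  on a set \<open>X\<close> consists of the finitely supported functions with support in \<open>X\<close>.\<close>

definition spanning_chains :: "'v gorder \<Rightarrow> nat \<Rightarrow> 'v list set" where
  "spanning_chains P n = {xs. length xs = Suc n \<and> set xs \<subseteq> carrier P
     \<and> sorted_wrt (\<lambda>x y. x \<sqsubset>\<^bsub>P\<^esub> y) xs \<and> minimal P (hd xs) \<and> maximal P (last xs)}"

definition cochains :: "'v gorder \<Rightarrow> nat \<Rightarrow> ('v list \<Rightarrow>\<^sub>0 'k::comm_ring_1) set" where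
  "cochains P n = {f. Poly_Mapping.keys f \<subseteq> spanning_chains P n}"

definition scale :: "'k::comm_ring_1 \<Rightarrow> ('b \<Rightarrow>\<^sub>0 'k) \<Rightarrow> ('b \<Rightarrow>\<^sub>0 'k)" where
  "scale c f = Poly_Mapping.map (\<lambda>a. c * a) f"

definition d_symbol :: "'v gorder \<Rightarrow> 'v list \<Rightarrow> ('v list \<Rightarrow>\<^sub>0 'k::comm_ring_1)" where
  "d_symbol P xs =
     (\<Sum>i\<in>{1..<length xs}. \<Sum>y\<in>{y \<in> carrier P. xs ! (i - 1) \<sqsubset>\<^bsub>P\<^esub> y \<and> y \<sqsubset>\<^bsub>P\<^esub> xs ! i}.
        Poly_Mapping.single (take i xs @ [y] @ drop i xs) ((- 1) ^ i))"

definition differential ::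
    "'v gorder \<Rightarrow> ('v list \<Rightarrow>\<^sub>0 'k::comm_ring_1) \<Rightarrow> ('v list \<Rightarrow>\<^sub>0 'k)" where
  "differential P f =
     (\<Sum>xs\<in>Poly_Mapping.keys f. scale (Poly_Mapping.lookup f xs) (d_symbol P xs))"

definition cocycles :: "'v gorder \<Rightarrow> nat \<Rightarrow> ('v list \<Rightarrow>\<^sub>0 'k::comm_ring_1) set" where
  "cocycles P n = {f \<in> cochains P n. differential P f = 0}"

definition coboundaries :: "'v gorder \<Rightarrow> nat \<Rightarrow> ('v list \<Rightarrow>\<^sub>0 'k::comm_ring_1) set" where
  "coboundaries P n = (case n of 0 \<Rightarrow> {0} | Suc m \<Rightarrow> differential P ` cochains P m)"

definition cohomology ::
    "'k::comm_ring_1 itself \<Rightarrow> 'v gorder \<Rightarrow> nat \<Rightarrow> ('v list \<Rightarrow>\<^sub>0 'k) set set" where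
  "cohomology K P n = subquotient (cocycles P n) (coboundaries P n)"

definition cohomology_free_of_rank ::
    "'k::comm_ring_1 itself \<Rightarrow> 'v gorder \<Rightarrow> nat \<Rightarrow> nat \<Rightarrow> bool" where
  "cohomology_free_of_rank K P n r \<longleftrightarrow>
     subquotient_free_of_rank scale
       (cocycles P n :: ('v list \<Rightarrow>\<^sub>0 'k) set) (coboundaries P n) r"


section \<open>The dual chain complex\<close>

text \<open>\<open>dual_chains P n\<close> is the module of linear forms on \<open>cochains P n\<close>; forms are extended
  by 0 outside of \<open>cochains P n\<close>, so that equality of forms is equality of functions.\<close>

definition dual_chains ::
    "'v gorder \<Rightarrow> nat \<Rightarrow> (('v list \<Rightarrow>\<^sub>0 'k::comm_ring_1) \<Rightarrow> 'k) set" where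
  "dual_chains P n = {\<phi>.
     (\<forall>f\<in>cochains P n. \<forall>g\<in>cochains P n. \<phi> (f + g) = \<phi> f + \<phi> g) \<and>
     (\<forall>c. \<forall>f\<in>cochains P n. \<phi> (scale c f) = c * \<phi> f) \<and>
     (\<forall>f. f \<notin> cochains P n \<longrightarrow> \<phi> f = 0)}"

text \<open>The transpose of the differential, from degree \<open>n + 1\<close> to degree \<open>n\<close>.\<close>

definition boundary ::
    "'v gorder \<Rightarrow> nat \<Rightarrow> (('v list \<Rightarrow>\<^sub>0 'k::comm_ring_1) \<Rightarrow> 'k) \<Rightarrow> (('v list \<Rightarrow>\<^sub>0 'k) \<Rightarrow> 'k)" where
  "boundary P n \<phi> = (\<lambda>f. if f \<in> cochains P n then \<phi> (differential P f) else 0)"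

definition dual_cycles ::
    "'v gorder \<Rightarrow> nat \<Rightarrow> (('v list \<Rightarrow>\<^sub>0 'k::comm_ring_1) \<Rightarrow> 'k) set" where
  "dual_cycles P n = (case n of 0 \<Rightarrow> dual_chains P 0
     | Suc m \<Rightarrow> {\<phi> \<in> dual_chains P (Suc m). boundary P m \<phi> = 0})"

definition dual_boundaries ::
    "'v gorder \<Rightarrow> nat \<Rightarrow> (('v list \<Rightarrow>\<^sub>0 'k::comm_ring_1) \<Rightarrow> 'k) set" where
  "dual_boundaries P n = boundary P n ` dual_chains P (Suc n)"

definition homology ::
    "'k::comm_ring_1 itself \<Rightarrow> 'v gorder \<Rightarrow> nat \<Rightarrow> (('v list \<Rightarrow>\<^sub>0 'k) \<Rightarrow> 'k) set set" where
  "homology K P n = subquotient (dual_cycles P n) (dual_boundaries P n)"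


section \<open>Cohen--Macaulay posets\<close>

text \<open>The length of the longest chain from \<open>x\<close> to \<open>y\<close>; in a graded poset, the common length
  of all maximal chains of \<open>[x,y]\<close>.\<close>

definition interval_rank :: "'v gorder \<Rightarrow> 'v \<Rightarrow> 'v \<Rightarrow> nat" where
  "interval_rank P x y = Max {n. spanning_chains (interval P x y) n \<noteq> {}}"

definition Cohen_Macaulay :: "'k::comm_ring_1 itself \<Rightarrow> 'v gorder \<Rightarrow> bool" where
  "Cohen_Macaulay K P \<longleftrightarrow> graded_poset P \<and>
     (\<forall>x\<in>carrier P. \<forall>y\<in>carrier P. x \<sqsubseteq>\<^bsub>P\<^esub> y \<longrightarrow>
        (\<forall>n. n \<noteq> interval_rank P x y \<longrightarrow> is_singleton (homology K (interval P x y) n)))"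


section \<open>The non-singleton boolean poset\<close>

text \<open>\<open>merging \<alpha> \<beta>\<close>: every block of \<open>\<alpha>\<close> is a union of blocks of \<open>\<beta>\<close>. Thus the least element
  is the one-block partition.\<close>

definition merging :: "'a set set \<Rightarrow> 'a set set \<Rightarrow> bool" where
  "merging \<alpha> \<beta> \<longleftrightarrow> (\<forall>A\<in>\<alpha>. \<exists>\<B>\<subseteq>\<beta>. A = \<Union>\<B>)"

definition NS :: "'a set \<Rightarrow> 'a set set gorder" where
  "NS S = \<lparr>
     carrier = {\<alpha>. partition_on S \<alpha> \<and> (\<forall>A\<in>\<alpha>. \<forall>B\<in>\<alpha>. 2 \<le> card A \<and> 2 \<le> card B \<longrightarrow> A = B)},
     eq = (=),
     le = merging\<rparr>"

end

theory Submission
  imports Defs "HOL-Library.Sublist"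
begin

text \<open>
  Let \<open>L\<close> be a finite semimodular lattice with rank function, \<open>x < y\<close>, and \<open>a \<le> y\<close> a cover
  of \<open>x\<close>. The closure \<open>z \<mapsto> z \<squnion> a\<close> yields a prism operator on the cochains of \<open>[x,y]\<close> that is a
  contraction away from the chains whose last element \<open>H\<close> before \<open>y\<close> satisfies \<open>H \<squnion> a = y\<close>.
  By semimodularity such an \<open>H\<close> is a coatom of \<open>[x,y]\<close>, so the remaining subcomplex is the direct
  sum of the shifted complexes of the intervals \<open>[x,H]\<close>. By induction on the rank, the cohomology of
  \<open>[x,y]\<close> lives in top degree, where it is free of rank
  \<open>r(x,y) = (\<Sum>H. r(x,H))\<close> with the sum over these coatoms; the contraction dualizes to homology.

  Sending a partition to its block with at least two elements identifies \<open>NS S\<close> with the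
  non-singleton subsets of \<open>S\<close> under reverse inclusion. With \<open>a\<close> the atom separating \<open>s\<close>, only
  \<open>H = D \<union> {s}\<close> contributes below a nonempty set \<open>D\<close>, and exactly the \<open>card S - 1\<close> pairs \<open>{s,t}\<close>
  contribute below the top element.
\<close>

section \<open>Alternating sums over sublists and the prism operator\<close>

text \<open>Without its fixed end points, the complex of [x,y] is the augmented simplicial cochain
  complex of the open interval, and \<open>alt_sum\<close> is its coboundary, defined for arbitrary
  functions on lists. \<open>prism\<close> is the classical homotopy from the identity to
  \<open>r\<close>, prolonged by a cone with apex \<open>r x\<close>, which is \<open>a\<close> for
  the closure; its homotopy identity is purely formal. Order matters only because the lists produced
  must be chains of the open interval: repetitions are harmless degenerate simplices, but z
  \<squnion> a may reach y, and this one obstruction produces the elements H. The recursion for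
  r(x,y) is that of Weisner's theorem on the Moebius function, so r(x,y) is the absolute value of
  \<mu>(x,y).

  Explicit linear operators take the place of exact sequences. They can be transposed, which settles
  the homology of the dual complex over every ring, and a contraction that vanishes on the surviving
  chains shows that these are independent modulo coboundaries.\<close>

fun alt_sum :: "('v list \<Rightarrow> 'k::comm_ring_1) \<Rightarrow> 'v list \<Rightarrow> 'k" where
  "alt_sum \<psi> [] = 0"
| "alt_sum \<psi> (z # zs) = \<psi> zs - alt_sum (\<lambda>ws. \<psi> (z # ws)) zs"

text \<open>With \<open>x\<^sub>0 = x\<close>, this is the alternating sum over \<open>k\<close> of the values of \<open>\<psi>\<close> at
  \<open>x\<^sub>1, \<dots>, x\<^sub>k, r x\<^sub>k, \<dots>, r x\<^sub>n\<close>: end points are fixed in the complex of an interval, so they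
  are left out of the lists.\<close>

fun prism :: "('v \<Rightarrow> 'v) \<Rightarrow> ('v list \<Rightarrow> 'k::comm_ring_1) \<Rightarrow> 'v \<Rightarrow> 'v list \<Rightarrow> 'k" where
  "prism r \<psi> x [] = \<psi> [r x]"
| "prism r \<psi> x (z # zs) = \<psi> (r x # map r (z # zs)) - prism r (\<lambda>ws. \<psi> (z # ws)) z zs"

text \<open>Bridges to the signs \<open>(- 1) ^ i\<close> of \<open>d_symbol\<close>. Otherwise the
  recursion is handier: deletion behind the head \<open>z\<close> is the same sum for
  \<open>\<lambda>ws. \<psi> (z # ws)\<close>.\<close>

lemma alt_sum_conv_sum:
  "alt_sum \<psi> ys = (\<Sum>j<length ys. (- 1) ^ j * \<psi> (take j ys @ drop (Suc j) ys))"
proof (induction ys arbitrary: \<psi>)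
  case (Cons z zs)
  show ?case
    by (simp add: Cons.IH sum.lessThan_Suc_shift sum_negf del: sum.lessThan_Suc)
qed simp

lemma alt_sum_add: "alt_sum (\<lambda>ws. \<phi> ws + \<psi> ws) ys = alt_sum \<phi> ys + alt_sum \<psi> ys"
  by (induction ys arbitrary: \<phi> \<psi>) simp_all

lemma alt_sum_diff: "alt_sum (\<lambda>ws. \<phi> ws - \<psi> ws) ys = alt_sum \<phi> ys - alt_sum \<psi> ys"
  by (induction ys arbitrary: \<phi> \<psi>) simp_all

lemma alt_sum_uminus: "alt_sum (\<lambda>ws. - \<psi> ws) ys = - alt_sum \<psi> ys"
  by (induction ys arbitrary: \<psi>) simp_all

lemma alt_sum_scale: "alt_sum (\<lambda>ws. c * \<psi> ws) ys = c * alt_sum \<psi> ys"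
  by (induction ys arbitrary: \<psi>) (simp_all add: right_diff_distrib)

lemma alt_sum_map: "alt_sum \<psi> (map r ys) = alt_sum (\<lambda>ws. \<psi> (map r ws)) ys"
  by (induction ys arbitrary: \<psi>) simp_all

lemma alt_sum_snoc:
  "alt_sum \<psi> (ys @ [z]) = alt_sum (\<lambda>ws. \<psi> (ws @ [z])) ys + (- 1) ^ length ys * \<psi> ys"
  by (induction ys arbitrary: \<psi>) simp_all

lemma alt_sum_cong:
  assumes "\<And>ws. subseq ws ys \<Longrightarrow> length ys = Suc (length ws) \<Longrightarrow> \<phi> ws = \<psi> ws"
  shows "alt_sum \<phi> ys = alt_sum \<psi> ys"
  using assms
proof (induction ys arbitrary: \<phi> \<psi>)
  case (Cons y ys)
  have "alt_sum (\<lambda>ws. \<phi> (y # ws)) ys = alt_sum (\<lambda>ws. \<psi> (y # ws)) ys"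
    by (rule Cons.IH, rule Cons.prems) simp_all
  moreover have "\<phi> ys = \<psi> ys"
    by (rule Cons.prems) auto
  ultimately show ?case
    by simp
qed simp

lemma alt_sum_alt_sum: "alt_sum (alt_sum \<psi>) ys = 0"
  by (induction ys arbitrary: \<psi>) (simp_all add: alt_sum_diff)

text \<open>The two deletions inside an adjacent pair of equal entries give the same list with
  opposite signs; every other deletion keeps the pair, where \<open>\<psi>\<close> vanishes. This
  disposes of the degenerate lists that \<open>prism\<close> creates when \<open>r\<close> fixes an
  entry.\<close>

lemma alt_sum_not_distinct_adj:
  assumes "\<And>ws. \<not> distinct_adj ws \<Longrightarrow> \<psi> ws = 0" and "\<not> distinct_adj ys"
  shows "alt_sum \<psi> ys = 0"
  using assms
proof (induction ys arbitrary: \<psi>)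
  case (Cons z zs)
  show ?case
  proof (cases "zs \<noteq> [] \<and> hd zs = z")
    case True
    then obtain zs' where zs: "zs = z # zs'"
      by (cases zs) auto
    have "alt_sum (\<lambda>ws. \<psi> (z # z # ws)) zs' = alt_sum (\<lambda>ws. 0 * \<psi> ws) zs'"
      by (rule alt_sum_cong) (simp add: Cons.prems)
    then show ?thesis
      by (simp add: zs alt_sum_scale[of 0, simplified])
  next
    case False
    with Cons.prems(2) have "\<not> distinct_adj zs"
      by (cases zs) auto
    moreover from this have "alt_sum (\<lambda>ws. \<psi> (z # ws)) zs = 0"
      by (intro Cons.IH Cons.prems(1)) (auto dest: distinct_adj_ConsD)
    ultimately show ?thesis
      by (simp add: Cons.prems(1))
  qed
qed simp

lemma prism_add: "prism r (\<lambda>ws. \<phi> ws + \<psi> ws) x ys = prism r \<phi> x ys + prism r \<psi> x ys"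
  by (induction ys arbitrary: \<phi> \<psi> x) simp_all

lemma prism_diff: "prism r (\<lambda>ws. \<phi> ws - \<psi> ws) x ys = prism r \<phi> x ys - prism r \<psi> x ys"
  by (induction ys arbitrary: \<phi> \<psi> x) simp_all

lemma prism_uminus: "prism r (\<lambda>ws. - \<psi> ws) x ys = - prism r \<psi> x ys"
  by (induction ys arbitrary: \<psi> x) simp_all

lemma prism_scale: "prism r (\<lambda>ws. c * \<psi> ws) x ys = c * prism r \<psi> x ys"
  by (induction ys arbitrary: \<psi> x) (simp_all add: right_diff_distrib)

text \<open>Only the summand with k = 0 sees the base point, through its first entry
  \<open>r x\<close>.\<close>

lemma prism_base_point:
  "prism r \<psi> x ys - prism r \<psi> z ys = \<psi> (r x # map r ys) - \<psi> (r z # map r ys)"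
  by (cases ys) simp_all

text \<open>Faces telescope: deleting \<open>x\<^sub>k\<close> from the k-th list gives the same
  list as deleting the first image entry from the list before it. Faces at all other entries cancel
  against \<open>alt_sum (prism r \<psi> x)\<close>. What is left is the deletion of the final
  \<open>r x\<^sub>n\<close> from the last list, which returns \<open>ys\<close>.\<close>

lemma prism_alt_sum:
  "prism r (alt_sum \<psi>) x ys + alt_sum (prism r \<psi> x) ys = \<psi> ys"
proof (induction ys arbitrary: \<psi> x)
  case (Cons z zs)
  define \<chi> where "\<chi> = alt_sum (\<lambda>ws. \<psi> (r x # r z # map r ws)) zs"
  have 1: "prism r (alt_sum \<psi>) x (z # zs) = \<psi> (r z # map r zs) - (\<psi> (r x # map r zs) - \<chi>)
      - (prism r \<psi> z zs - prism r (alt_sum (\<lambda>ws. \<psi> (z # ws))) z zs)"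
    by (simp add: prism_diff alt_sum_map \<chi>_def)
  have 2: "alt_sum (prism r \<psi> x) (z # zs) =
      prism r \<psi> x zs - (\<chi> - alt_sum (prism r (\<lambda>ws. \<psi> (z # ws)) z) zs)"
    by (simp add: alt_sum_diff \<chi>_def)
  \<comment> \<open>Q + R is \<open>\<psi> (z # zs)\<close> by the induction hypothesis at base
    point \<open>z\<close>, and X - P = q - p is \<open>prism_base_point\<close>. The term
    \<open>\<chi>\<close>, the faces of the k = 0 list behind its first two entries,
    cancels.\<close>
  have 3: "p - (q - \<chi>) - (P - Q) + (X - (\<chi> - R)) = (Q + R) + ((X - P) - (q - p))" for p q P Q X R
    by (simp add: algebra_simps)
  have "prism r (alt_sum \<psi>) x (z # zs) + alt_sum (prism r \<psi> x) (z # zs) = \<psi> (z # zs) +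
      ((\<psi> (r x # map r zs) - \<psi> (r z # map r zs)) - (\<psi> (r x # map r zs) - \<psi> (r z # map r zs)))"
    unfolding 1 2 3 by (rule arg_cong2[where f = "(+)"], rule Cons.IH,
      rule arg_cong2[where f = "(-)"], rule prism_base_point, rule refl)
  then show ?case
    by (simp only: diff_self add_0_right)
next
  case Nil
  have "alt_sum \<psi> [r x] = \<psi> []"
    by simp
  then show ?case
    by (simp only: prism.simps alt_sum.simps add_0_right)
qed

text \<open>Extensivity and monotonicity of \<open>r\<close> make every list that
  \<open>prism\<close> evaluates weakly increasing, with last entry
  \<open>r (last (x # ys))\<close>. Strictness cannot be promised, hence the separate treatment of
  repetitions.\<close>

lemma (in partial_order) prism_cong:
  assumes "sorted_wrt (\<sqsubseteq>) (x # ys)" and "set (x # ys) \<subseteq> carrier L"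
    and r: "\<And>z. z \<in> carrier L \<Longrightarrow> r z \<in> carrier L \<and> z \<sqsubseteq> r z"
    "\<And>z w. z \<in> carrier L \<Longrightarrow> w \<in> carrier L \<Longrightarrow> z \<sqsubseteq> w \<Longrightarrow> r z \<sqsubseteq> r w"
    and "\<And>ws. \<lbrakk>sorted_wrt (\<sqsubseteq>) (x # ws); set ws \<subseteq> set ys \<union> r ` set (x # ys);
      length ws = Suc (length ys); last ws = r (last (x # ys))\<rbrakk> \<Longrightarrow> \<phi> ws = \<psi> ws"
  shows "prism r \<phi> x ys = prism r \<psi> x ys"
  using assms(1,2,5)
proof (induction ys arbitrary: x \<phi> \<psi>)
  case Nil
  have "\<phi> [r x] = \<psi> [r x]"
    using Nil.prems(2) r(1)[of x] by (intro Nil.prems(3)) auto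
  then show ?case
    by simp
next
  case (Cons z zs)
  have "\<phi> (r x # map r (z # zs)) = \<psi> (r x # map r (z # zs))"
  proof (rule Cons.prems(3))
    have "sorted_wrt (\<sqsubseteq>) (map r (x # z # zs))"
      unfolding sorted_wrt_map
      by (rule sorted_wrt_mono_rel[OF _ Cons.prems(1)]) (use Cons.prems(2) in \<open>auto intro!: r(2)\<close>)
    moreover
    have "x \<sqsubseteq> r v" if "v \<in> set (x # z # zs)" for v
    proof (rule le_trans[of x v "r v"])
      show v: "v \<in> carrier L" "x \<in> carrier L" "x \<sqsubseteq> v"
        using that Cons.prems(1,2) by auto
      show "v \<sqsubseteq> r v" "r v \<in> carrier L"
        using r(1)[OF v(1)] by simp_all
    qed
    then have "\<forall>v\<in>set (map r (x # z # zs)). x \<sqsubseteq> v"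
      by (simp only: set_map ball_simps) blast
    ultimately show "sorted_wrt (\<sqsubseteq>) (x # r x # map r (z # zs))"
      by simp
    show "set (r x # map r (z # zs)) \<subseteq> set (z # zs) \<union> r ` set (x # z # zs)"
      by auto
    show "last (r x # map r (z # zs)) = r (last (x # z # zs))"
      by (simp add: last_map)
  qed simp
  moreover have "prism r (\<lambda>ws. \<phi> (z # ws)) z zs = prism r (\<lambda>ws. \<psi> (z # ws)) z zs"
  proof (rule Cons.IH)
    fix ws
    assume ws: "sorted_wrt (\<sqsubseteq>) (z # ws)" "set ws \<subseteq> set zs \<union> r ` set (z # zs)"
      "length ws = Suc (length zs)" "last ws = r (last (z # zs))"
    have "r ` set (z # zs) \<subseteq> carrier L"
      using Cons.prems(2) by (intro image_subsetI conjunct1[OF r(1)]) auto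
    then have "set zs \<union> r ` set (z # zs) \<subseteq> carrier L"
      using Cons.prems(2) by simp
    with ws(2) have "set ws \<subseteq> carrier L"
      by (rule order_trans)
    then have "\<forall>v\<in>set ws. x \<sqsubseteq> v"
      using ws(1) Cons.prems(1,2) by (intro ballI, rule_tac le_trans[of x z]) auto
    with ws(1) Cons.prems(1) have "sorted_wrt (\<sqsubseteq>) (x # z # ws)"
      by simp
    moreover have "set (z # ws) \<subseteq> set (z # zs) \<union> r ` set (x # z # zs)"
      using ws(2) by auto
    moreover have "last (z # ws) = r (last (x # z # zs))"
      using ws(3,4) by auto
    ultimately show "\<phi> (z # ws) = \<psi> (z # ws)"
      using ws(3) by (intro Cons.prems(3)) simp_all
  qed (use Cons.prems(1,2) in auto)
  ultimately show ?case
    by (simp only: prism.simps)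
qed

lemma (in partial_order) sorted_wrt_lless:
  assumes "sorted_wrt (\<sqsubseteq>) xs" and "set xs \<subseteq> carrier L" and "distinct_adj xs"
  shows "sorted_wrt (\<sqsubset>) xs"
  using assms
proof (induction xs rule: induct_list012)
  case (3 x y zs)
  then have "sorted_wrt (\<sqsubset>) (y # zs)"
    by simp
  moreover have "x \<sqsubset> y"
    using 3 by (simp add: lless_eq)
  moreover have "x \<sqsubset> z" if "z \<in> set zs" for z
    using \<open>x \<sqsubset> y\<close> \<open>sorted_wrt (\<sqsubset>) (y # zs)\<close> that "3.prems"(2)
    by (intro lless_trans[of x y z]) auto
  ultimately show ?case
    by simp
qed simp_all

lemma sorted_wrt_subseq: "subseq xs ys \<Longrightarrow> sorted_wrt P ys \<Longrightarrow> sorted_wrt P xs"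
  by (induction rule: list_emb.induct) (auto dest: list_emb_set)

lemma alt_sum_zero: "alt_sum (\<lambda>ws. 0) ys = 0"
  by (induction ys) simp_all

lemma prism_zero: "prism r (\<lambda>ws. 0) x ys = 0"
  by (induction ys arbitrary: x) simp_all

section \<open>Intervals of finite semimodular lattices\<close>

locale ranked_semimodular_lattice = lattice L for L :: "'v gorder" (structure) +
  fixes rk :: "'v \<Rightarrow> nat"
  assumes finite_carrier: "finite (carrier L)"
    and semimodular: "semimodular L"
    and rk_covered: "covered L x y \<Longrightarrow> rk y = Suc (rk x)"
begin

definition chains :: "'v \<Rightarrow> 'v \<Rightarrow> 'v list set" where
  "chains x y = {xs. xs \<noteq> [] \<and> set xs \<subseteq> carrier L \<and> sorted_wrt (\<sqsubset>) xs \<and> hd xs = x \<and> last xs = y}"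

text \<open>Here \<open>n\<close> counts the elements of a chain, so \<open>coch x y (Suc n)\<close> has degree \<open>n\<close>.\<close>

definition coch :: "'v \<Rightarrow> 'v \<Rightarrow> nat \<Rightarrow> ('v list \<Rightarrow> 'k::comm_ring_1) set" where
  "coch x y n = {\<phi>. \<forall>xs. \<phi> xs \<noteq> 0 \<longrightarrow> xs \<in> chains x y \<and> length xs = n}"

text \<open>This is \<open>differential\<close> read pointwise: as that map inserts elements, its
  value at \<open>xs\<close> runs over deletions from \<open>xs\<close>. The minus sign comes from
  positions: the j-th inner entry, counted from 0, has index j + 1 in \<open>xs\<close>.\<close>

definition cobound :: "'v \<Rightarrow> 'v \<Rightarrow> ('v list \<Rightarrow> 'k::comm_ring_1) \<Rightarrow> 'v list \<Rightarrow> 'k" where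
  "cobound x y \<phi> xs =
    (if xs \<in> chains x y then - alt_sum (\<lambda>ws. \<phi> (x # ws @ [y])) (butlast (tl xs)) else 0)"

lemma not_lless_self: "\<not> x \<sqsubset> x"
  by (simp add: lless_eq)

lemma chains_self: "x \<in> carrier L \<Longrightarrow> chains x x = {[x]}"
proof (intro equalityI subsetI)
  fix xs
  assume x: "x \<in> carrier L" and "xs \<in> chains x x"
  then obtain ys where xs: "xs = x # ys" "sorted_wrt (\<sqsubset>) (x # ys)" "last (x # ys) = x"
    unfolding chains_def by (cases xs) auto
  have "ys = []"
  proof (rule ccontr)
    assume "ys \<noteq> []"
    with xs(3) have "x \<in> set ys"
      by (metis last_ConsR last_in_set)
    with xs(2) show False
      using not_lless_self[of x] by simp
  qed
  with xs(1) show "xs \<in> {[x]}"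
    by simp
qed (simp add: chains_def)

lemma chains_ends:
  assumes "xs \<in> chains x y" and "x \<noteq> y"
  obtains ys where "xs = x # ys @ [y]"
proof -
  from assms obtain zs where zs: "xs = x # zs" "last (x # zs) = y"
    unfolding chains_def by (cases xs) auto
  with assms(2) have "zs = butlast zs @ [y]"
    by (metis append_butlast_last_id last_ConsL last_ConsR)
  with zs(1) show ?thesis
    using that by blast
qed

lemma chains_Cons_snoc_iff:
  "x # ys @ [y] \<in> chains x y \<longleftrightarrow> x \<in> carrier L \<and> y \<in> carrier L \<and> x \<sqsubset> y \<and> set ys \<subseteq> carrier L \<and>
    sorted_wrt (\<sqsubset>) ys \<and> (\<forall>z\<in>set ys. x \<sqsubset> z \<and> z \<sqsubset> y)"
  by (auto simp: chains_def sorted_wrt_append)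

lemma chains_subseq:
  assumes "x # ys @ [y] \<in> chains x y" and "subseq ws ys"
  shows "x # ws @ [y] \<in> chains x y"
proof -
  have "sorted_wrt (\<sqsubset>) ws"
    using assms sorted_wrt_subseq by (auto simp: chains_Cons_snoc_iff)
  moreover have "set ws \<subseteq> set ys"
    using assms(2) by (auto dest: list_emb_set)
  ultimately show ?thesis
    using assms(1) unfolding chains_Cons_snoc_iff by blast
qed

lemma chain_le_last:
  assumes "xs \<in> chains x y" and "z \<in> set xs"
  shows "z \<sqsubseteq> y"
proof -
  have xs: "xs = butlast xs @ [y]" and c: "set xs \<subseteq> carrier L" and s: "sorted_wrt (\<sqsubset>) xs"
    using assms(1) by (auto simp: chains_def)
  from assms(2) xs have "z \<in> set (butlast xs) \<or> z = y"
    by (metis Un_iff empty_iff insert_iff list.set(1) list.simps(15) set_append)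
  then show ?thesis
  proof
    assume "z \<in> set (butlast xs)"
    moreover from s xs have "sorted_wrt (\<sqsubset>) (butlast xs @ [y])"
      by simp
    ultimately show ?thesis
      by (simp add: sorted_wrt_append lless_eq)
  next
    assume "z = y"
    with assms(2) c show ?thesis
      by auto
  qed
qed

lemma chain_first_le:
  assumes "xs \<in> chains x y" and "z \<in> set xs"
  shows "x \<sqsubseteq> z"
  using assms by (cases xs) (auto simp: chains_def lless_eq)

lemma chains_closed: "xs \<in> chains x y \<Longrightarrow> x \<in> carrier L \<and> y \<in> carrier L"
  unfolding chains_def by (auto simp: subset_iff)

lemma snoc_in_chains_iff:
  assumes "xs \<noteq> []"
  shows "xs @ [y] \<in> chains x y \<longleftrightarrow> xs \<in> chains x (last xs) \<and> y \<in> carrier L \<and> last xs \<sqsubset> y"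
proof
  assume "xs @ [y] \<in> chains x y"
  then show "xs \<in> chains x (last xs) \<and> y \<in> carrier L \<and> last xs \<sqsubset> y"
    using assms by (auto simp: chains_def sorted_wrt_append)
next
  assume *: "xs \<in> chains x (last xs) \<and> y \<in> carrier L \<and> last xs \<sqsubset> y"
  have "z \<sqsubset> y" if "z \<in> set xs" for z
  proof -
    have "z \<sqsubseteq> last xs" "z \<in> carrier L" "last xs \<in> carrier L"
      using * that chain_le_last[of xs x "last xs" z] by (auto simp: chains_def)
    with * show ?thesis
      by (cases "z = last xs") (simp_all add: lless_eq lless_trans[of z "last xs" y, unfolded lless_eq])
  qed
  with * assms show "xs @ [y] \<in> chains x y"
    by (auto simp: chains_def sorted_wrt_append)
qed

lemma cobound_Cons_snoc:
  "x # ys @ [y] \<in> chains x y \<Longrightarrow>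
    cobound x y \<phi> (x # ys @ [y]) = - alt_sum (\<lambda>ws. \<phi> (x # ws @ [y])) ys"
  by (simp add: cobound_def)

lemma coch_nonzeroD: "\<phi> \<in> coch x y n \<Longrightarrow> \<phi> xs \<noteq> 0 \<Longrightarrow> xs \<in> chains x y \<and> length xs = n"
  by (simp add: coch_def)

lemma coch_eq_0: "\<phi> \<in> coch x y n \<Longrightarrow> xs \<notin> chains x y \<or> length xs \<noteq> n \<Longrightarrow> \<phi> xs = 0"
  by (auto simp: coch_def)

lemma coch_zero [simp]: "0 \<in> coch x y n"
  by (simp add: coch_def)

lemma coch_0: "\<phi> \<in> coch x y 0 \<Longrightarrow> \<phi> = 0"
  by (auto simp: coch_def chains_def fun_eq_iff)

lemma coch_add: "\<phi> \<in> coch x y n \<Longrightarrow> \<psi> \<in> coch x y n \<Longrightarrow> \<phi> + \<psi> \<in> coch x y n"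
  unfolding coch_def by (simp, metis add.right_neutral)

lemma coch_diff: "\<phi> \<in> coch x y n \<Longrightarrow> \<psi> \<in> coch x y n \<Longrightarrow> \<phi> - \<psi> \<in> coch x y n"
  unfolding coch_def by (simp, metis)

lemma cobound_self: "x \<in> carrier L \<Longrightarrow> cobound x x \<phi> = 0"
  by (simp add: cobound_def chains_self fun_eq_iff)

lemma cobound_add: "cobound x y (\<phi> + \<psi>) = cobound x y \<phi> + cobound x y \<psi>"
  by (simp add: cobound_def fun_eq_iff alt_sum_add)

lemma cobound_diff: "cobound x y (\<phi> - \<psi>) = cobound x y \<phi> - cobound x y \<psi>"
  by (simp add: cobound_def fun_eq_iff alt_sum_diff)

lemma cobound_zero: "cobound x y 0 = 0"
  by (simp add: cobound_def fun_eq_iff alt_sum_zero)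

lemma cobound_scale: "cobound x y (\<lambda>xs. c * \<phi> xs) = (\<lambda>xs. c * cobound x y \<phi> xs)"
  by (simp add: cobound_def fun_eq_iff alt_sum_scale)

lemma cobound_eq_0I:
  assumes "\<And>ys ws. xs = x # ys @ [y] \<Longrightarrow> xs \<in> chains x y \<Longrightarrow> subseq ws ys \<Longrightarrow>
      length ys = Suc (length ws) \<Longrightarrow> x # ws @ [y] \<in> chains x y \<Longrightarrow> \<phi> (x # ws @ [y]) = 0"
  shows "cobound x y \<phi> xs = 0"
proof (cases "xs \<in> chains x y")
  case True
  show ?thesis
  proof (cases "x = y")
    case True
    with \<open>xs \<in> chains x y\<close> show ?thesis
      using chains_closed[of xs x y] by (simp add: cobound_self)
  next
    case False
    with True obtain ys where xs: "xs = x # ys @ [y]"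
      using chains_ends by blast
    have "alt_sum (\<lambda>ws. \<phi> (x # ws @ [y])) ys = alt_sum (\<lambda>ws. 0) ys"
      by (rule alt_sum_cong, rule assms[OF xs True]) (use True xs chains_subseq in auto)
    then have "alt_sum (\<lambda>ws. \<phi> (x # ws @ [y])) ys = 0"
      by (simp only: alt_sum_zero)
    then show ?thesis
      by (simp add: cobound_def xs)
  qed
qed (simp add: cobound_def)

lemma cobound_coch:
  assumes "\<phi> \<in> coch x y n"
  shows "cobound x y \<phi> \<in> coch x y (Suc n)"
proof -
  have "length xs = Suc n" if "cobound x y \<phi> xs \<noteq> 0" for xs
  proof (rule ccontr)
    assume "length xs \<noteq> Suc n"
    then have "cobound x y \<phi> xs = 0"
      by (intro cobound_eq_0I coch_eq_0[OF assms]) auto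
    with that show False ..
  qed
  moreover have "xs \<in> chains x y" if "cobound x y \<phi> xs \<noteq> 0" for xs
    using that unfolding cobound_def by (rule contrapos_np) simp
  ultimately show ?thesis
    unfolding coch_def by blast
qed

lemma cobound_cobound: "cobound x y (cobound x y \<phi>) = 0"
proof
  fix xs
  show "cobound x y (cobound x y \<phi>) xs = 0 xs"
  proof (cases "xs \<in> chains x y \<and> x \<noteq> y")
    case True
    then obtain ys where xs: "xs = x # ys @ [y]"
      using chains_ends by blast
    with True have *: "x # ys @ [y] \<in> chains x y"
      by simp
    have "alt_sum (\<lambda>ws. cobound x y \<phi> (x # ws @ [y])) ys =
        alt_sum (\<lambda>ws. - alt_sum (\<lambda>ws. \<phi> (x # ws @ [y])) ws) ys"
      by (rule alt_sum_cong, rule cobound_Cons_snoc, rule chains_subseq[OF *])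
    then show ?thesis
      by (simp add: xs cobound_Cons_snoc[OF *] alt_sum_uminus alt_sum_alt_sum)
  next
    case False
    then show ?thesis
      using chains_closed[of xs x y]
      by (cases "xs \<in> chains x y") (auto simp: cobound_self, simp add: cobound_def)
  qed
qed

end

section \<open>The prism contraction of an interval given by a cover of its least element\<close>

locale interval_atom = ranked_semimodular_lattice L rk for L :: "'v gorder" (structure) and rk +
  fixes x y a
  assumes covered_a: "covered L x a" and a_le: "a \<sqsubseteq> y" and y_closed: "y \<in> carrier L"
begin

definition clo :: "'v \<Rightarrow> 'v" where
  "clo z = z \<squnion> a"

text \<open>The minus sign matches the one in \<open>cobound\<close>, so that both disappear from
  the homotopy formula.\<close>

definition cone :: "('v list \<Rightarrow> 'k::comm_ring_1) \<Rightarrow> 'v list \<Rightarrow> 'k" where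
  "cone \<phi> xs = (if xs \<in> chains x y
    then - prism clo (\<lambda>ws. \<phi> (x # ws @ [y])) x (butlast (tl xs)) else 0)"

lemma a_closed: "a \<in> carrier L" and x_closed: "x \<in> carrier L" and x_less_a: "x \<sqsubset> a"
  using covered_a by (auto simp: covered_def)

lemma x_less_y: "x \<sqsubset> y"
  using x_less_a a_le x_closed a_closed y_closed
  by (metis le_antisym le_trans lless_eq)

lemma clo_closed: "z \<in> carrier L \<Longrightarrow> clo z \<in> carrier L"
  and clo_ge: "z \<in> carrier L \<Longrightarrow> z \<sqsubseteq> clo z"
  and a_le_clo: "z \<in> carrier L \<Longrightarrow> a \<sqsubseteq> clo z"
  by (simp_all add: clo_def a_closed join_left join_right)

lemma clo_least: "z \<in> carrier L \<Longrightarrow> w \<in> carrier L \<Longrightarrow> z \<sqsubseteq> w \<Longrightarrow> a \<sqsubseteq> w \<Longrightarrow> clo z \<sqsubseteq> w"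
  by (simp add: clo_def a_closed join_le)

lemma clo_mono: "z \<in> carrier L \<Longrightarrow> w \<in> carrier L \<Longrightarrow> z \<sqsubseteq> w \<Longrightarrow> clo z \<sqsubseteq> clo w"
  by (meson a_le_clo clo_closed clo_ge clo_least le_trans)

lemma clo_eq: "z \<in> carrier L \<Longrightarrow> a \<sqsubseteq> z \<Longrightarrow> clo z = z"
  by (meson clo_closed clo_ge clo_least le_antisym weak_refl refl)

lemma clo_clo: "z \<in> carrier L \<Longrightarrow> clo (clo z) = clo z"
  by (simp add: clo_eq a_le_clo clo_closed)

text \<open>These turn out to be the coatoms of [x,y] not above \<open>a\<close>. If y = a, the only
  one is x, and the recursion ends in a one-point interval.\<close>

definition coatoms_off :: "'v set" where
  "coatoms_off = {H \<in> carrier L. x \<sqsubseteq> H \<and> H \<sqsubset> y \<and> clo H = y}"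

text \<open>As \<open>a\<close> is not below H (otherwise \<open>clo H = H\<close>), the meet of
  \<open>a\<close> and H is x, which \<open>a\<close> covers. Semimodularity moves this cover up to
  y over H; the contraction argument appeals to it only here.\<close>

lemma coatoms_off_covered:
  assumes "H \<in> coatoms_off"
  shows "covered L H y"
proof -
  have H: "H \<in> carrier L" "x \<sqsubseteq> H" "H \<sqsubset> y" "clo H = y"
    using assms by (auto simp: coatoms_off_def)
  have m: "a \<sqinter> H \<in> carrier L" "a \<sqinter> H \<sqsubseteq> a" "a \<sqinter> H \<sqsubseteq> H" "x \<sqsubseteq> a \<sqinter> H"
    using H a_closed x_closed x_less_a by (simp_all add: meet_left meet_right meet_le lless_eq)
  have "a \<sqinter> H \<noteq> a"
    using m H clo_eq[of H] by (auto simp: lless_eq)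
  then have "a \<sqinter> H = x"
    using covered_a m unfolding covered_def lless_eq by metis
  then have "covered L H (a \<squnion> H)"
    using semimodular covered_a a_closed H(1) unfolding semimodular_def by metis
  moreover have "a \<squnion> H = y"
    using H(4) by (simp add: clo_def join_comm)
  ultimately show ?thesis
    by simp
qed

lemma coatoms_off_incomparable: "H \<in> coatoms_off \<Longrightarrow> K \<in> coatoms_off \<Longrightarrow> \<not> K \<sqsubset> H"
  using coatoms_off_covered[of K] unfolding covered_def coatoms_off_def by blast

lemma cone_add: "cone (\<phi> + \<psi>) = cone \<phi> + cone \<psi>"
  by (simp add: cone_def fun_eq_iff prism_add)

lemma cone_zero: "cone 0 = 0"
  by (simp add: cone_def fun_eq_iff prism_zero)

lemma cone_scale: "cone (\<lambda>xs. c * \<phi> xs) = (\<lambda>xs. c * cone \<phi> xs)"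
  by (simp add: cone_def fun_eq_iff prism_scale)

lemma cone_Cons_snoc:
  "x # ys @ [y] \<in> chains x y \<Longrightarrow>
    cone \<phi> (x # ys @ [y]) = - prism clo (\<lambda>ws. \<phi> (x # ws @ [y])) x ys"
  by (simp add: cone_def)

lemma chain_obtain:
  assumes "xs \<in> chains x y"
  obtains ys where "xs = x # ys @ [y]"
  using assms chains_ends x_less_y by (metis lless_eq)

lemma prism_clo_cong:
  assumes "x # ys @ [y] \<in> chains x y"
    and "\<And>ws. \<lbrakk>sorted_wrt (\<sqsubseteq>) (x # ws); set ws \<subseteq> set ys \<union> clo ` set (x # ys);
      length ws = Suc (length ys); last ws = clo (last (x # ys))\<rbrakk> \<Longrightarrow> \<phi> ws = \<psi> ws"
  shows "prism clo \<phi> x ys = prism clo \<psi> x ys"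
proof (rule prism_cong)
  have *: "sorted_wrt (\<sqsubset>) (x # ys)" "set (x # ys) \<subseteq> carrier L"
    using assms(1) by (auto simp: chains_Cons_snoc_iff)
  show "sorted_wrt (\<sqsubseteq>) (x # ys)"
    by (rule sorted_wrt_mono_rel[OF _ *(1)]) (simp add: lless_eq)
  show "set (x # ys) \<subseteq> carrier L"
    by (rule *)
  show "\<phi> ws = \<psi> ws" if "sorted_wrt (\<sqsubseteq>) (x # ws)" "set ws \<subseteq> set ys \<union> clo ` set (x # ys)"
      "length ws = Suc (length ys)" "last ws = clo (last (x # ys))" for ws
    using that by (rule assms(2))
qed (simp_all add: clo_closed clo_ge clo_mono)

lemma cone_eq_0I:
  assumes "\<And>ys ws. xs = x # ys @ [y] \<Longrightarrow> xs \<in> chains x y \<Longrightarrow> length ws = Suc (length ys) \<Longrightarrow>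
    last ws = clo (last (x # ys)) \<Longrightarrow> \<phi> (x # ws @ [y]) = 0"
  shows "cone \<phi> xs = 0"
proof (cases "xs \<in> chains x y")
  case True
  then obtain ys where xs: "xs = x # ys @ [y]"
    by (rule chain_obtain)
  have "prism clo (\<lambda>ws. \<phi> (x # ws @ [y])) x ys = prism clo (\<lambda>ws. 0) x ys"
    by (rule prism_clo_cong) (use True xs in simp, rule assms[OF xs True], assumption+)
  then show ?thesis
    by (simp add: cone_def xs prism_zero)
qed (simp add: cone_def)

lemma cone_coch:
  assumes "\<phi> \<in> coch x y n"
  shows "cone \<phi> \<in> coch x y (n - 1)"
proof -
  have "length xs = n - 1" if "cone \<phi> xs \<noteq> 0" for xs
  proof (rule ccontr)
    assume "length xs \<noteq> n - 1"
    then have "cone \<phi> xs = 0"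
      by (intro cone_eq_0I coch_eq_0[OF assms]) auto
    with that show False ..
  qed
  moreover have "xs \<in> chains x y" if "cone \<phi> xs \<noteq> 0" for xs
    using that unfolding cone_def by (rule contrapos_np) simp
  ultimately show ?thesis
    unfolding coch_def by blast
qed

lemma not_chain_repeat: "\<not> distinct_adj ws \<Longrightarrow> x # ws @ [y] \<notin> chains x y"
  unfolding chains_Cons_snoc_iff
  by (induction ws rule: induct_list012) (auto simp: not_lless_self)

lemma last_Cons_chain:
  assumes "x # ys @ [y] \<in> chains x y" and "subseq ws ys"
  shows "last (x # ws) \<sqsubseteq> last (x # ys)" "last (x # ws) \<in> carrier L" "last (x # ys) \<in> carrier L"
    "last (x # ys) \<sqsubset> y" "x \<sqsubseteq> last (x # ys)"
proof -
  have c: "x # ys \<in> chains x (last (x # ys))" and l: "last (x # ys) \<sqsubset> y"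
    using assms(1) snoc_in_chains_iff[of "x # ys" y x] by auto
  have "set ws \<subseteq> set ys"
    using assms(2) by (auto dest: list_emb_set)
  then have w: "last (x # ws) \<in> set (x # ys)"
    using last_in_set[of ws] by (cases "ws = []") (simp_all add: subset_iff)
  show "last (x # ws) \<sqsubseteq> last (x # ys)" "x \<sqsubseteq> last (x # ys)"
    using chain_le_last[OF c] w by auto
  show "last (x # ws) \<in> carrier L" "last (x # ys) \<in> carrier L"
    using c w last_in_set[of "x # ys"] unfolding chains_def by auto
  show "last (x # ys) \<sqsubset> y"
    by (rule l)
qed

text \<open>If the closure of the last inner element stays below y, the lists that
  \<open>prism\<close> evaluates have all entries strictly between x and y. On those without
  repetition \<open>cobound\<close> is the formal alternating sum; on the others both sides are 0.
  Then \<open>prism_alt_sum\<close> applies.\<close>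

lemma cone_homotopy:
  assumes "\<phi> \<in> coch x y n" and "xs \<in> chains x y" and off: "clo (last (butlast xs)) \<noteq> y"
  shows "cobound x y (cone \<phi>) xs + cone (cobound x y \<phi>) xs = \<phi> xs"
proof -
  obtain ys where xs: "xs = x # ys @ [y]"
    using assms(2) by (rule chain_obtain)
  define \<psi> where "\<psi> = (\<lambda>ws. \<phi> (x # ws @ [y]))"
  have c: "x # ys @ [y] \<in> chains x y"
    using assms(2) xs by simp
  have off': "clo (last (x # ys)) \<noteq> y"
    using off by (simp add: xs butlast_append)
  note l = last_Cons_chain[OF c subseq_order.order_refl]
  have "alt_sum (\<lambda>ws. cone \<phi> (x # ws @ [y])) ys = alt_sum (\<lambda>ws. - prism clo \<psi> x ws) ys"
    unfolding \<psi>_def by (rule alt_sum_cong, rule cone_Cons_snoc, rule chains_subseq[OF c])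
  then have 1: "cobound x y (cone \<phi>) xs = alt_sum (prism clo \<psi> x) ys"
    by (simp add: xs cobound_Cons_snoc[OF c] alt_sum_uminus)
  have "prism clo (\<lambda>ws. cobound x y \<phi> (x # ws @ [y])) x ys = prism clo (\<lambda>ws. - alt_sum \<psi> ws) x ys"
  proof (rule prism_clo_cong[OF c])
    fix ws
    assume ws: "sorted_wrt (\<sqsubseteq>) (x # ws)" "set ws \<subseteq> set ys \<union> clo ` set (x # ys)"
    show "cobound x y \<phi> (x # ws @ [y]) = - alt_sum \<psi> ws"
    proof (cases "distinct_adj ws")
      case True
      have z: "z \<in> carrier L \<and> x \<sqsubset> z \<and> z \<sqsubset> y" if zw: "z \<in> set ws" for z
      proof -
        consider "z \<in> set ys" | u where "u \<in> set (x # ys)" "z = clo u"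
          using zw ws(2) by blast
        then show ?thesis
        proof cases
          case 1
          then show ?thesis
            using c unfolding chains_Cons_snoc_iff by auto
        next
          case 2
          have c': "x # ys \<in> chains x (last (x # ys))"
            using c snoc_in_chains_iff[of "x # ys" y x] by simp
          have u: "u \<in> carrier L" "u \<sqsubseteq> last (x # ys)"
            using 2 c' chain_le_last[OF c' 2(1)] by (auto simp: chains_def)
          have z: "z \<in> carrier L" "a \<sqsubseteq> z" "z \<sqsubseteq> clo (last (x # ys))"
            using u l 2 by (auto intro: clo_closed a_le_clo clo_mono)
          \<comment> \<open>The hypothesis \<open>off\<close> enters here: this closure bounds all
            other closures, so none of them reaches y.\<close>
          have "clo (last (x # ys)) \<sqsubset> y"
            using off' l y_closed a_le clo_least by (simp add: lless_eq)
          moreover have "clo (last (x # ys)) \<in> carrier L"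
            using l by (intro clo_closed)
          ultimately have "z \<sqsubset> y"
            using z y_closed by (metis le_antisym le_trans lless_eq)
          moreover have "x \<sqsubset> z"
            using z x_less_a x_closed a_closed by (metis le_antisym le_trans lless_eq)
          ultimately show ?thesis
            using z by blast
        qed
      qed
      moreover have "sorted_wrt (\<sqsubset>) ws"
        by (rule sorted_wrt_lless) (use ws True z in auto)
      ultimately have "x # ws @ [y] \<in> chains x y"
        unfolding chains_Cons_snoc_iff using x_less_y x_closed y_closed by blast
      then show ?thesis
        by (simp add: cobound_Cons_snoc \<psi>_def)
    next
      case False
      have "alt_sum \<psi> ws = 0"
        by (rule alt_sum_not_distinct_adj[OF _ False], unfold \<psi>_def, rule coch_eq_0[OF assms(1)])
          (use not_chain_repeat in blast)
      then show ?thesis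
        using not_chain_repeat[OF False] by (simp add: cobound_def)
    qed
  qed
  then have 2: "cone (cobound x y \<phi>) xs = prism clo (alt_sum \<psi>) x ys"
    by (simp add: xs cone_Cons_snoc[OF c] prism_uminus)
  show ?thesis
    unfolding 1 2 using prism_alt_sum[of clo \<psi> x ys] by (simp add: \<psi>_def xs add.commute)
qed

text \<open>Support on what \<open>cone_homotopy\<close> leaves out. Such cochains on [x,y] form a
  subcomplex on which \<open>cone\<close> vanishes.\<close>

definition critical :: "('v list \<Rightarrow> 'k::comm_ring_1) \<Rightarrow> bool" where
  "critical \<phi> \<longleftrightarrow> (\<forall>xs. \<phi> xs \<noteq> 0 \<longrightarrow> clo (last (butlast xs)) = y)"

text \<open>Every list that \<open>prism\<close> evaluates ends in a closed element. The closure can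
  send that element to y only if it is y already, and then the list is not the interior of a
  chain.\<close>

lemma cone_critical:
  assumes "\<forall>xs. \<phi> xs \<noteq> 0 \<longrightarrow> xs \<in> chains x y" and "critical \<phi>"
  shows "cone \<phi> = 0"
proof
  fix xs
  show "cone \<phi> xs = 0 xs"
    unfolding zero_fun_def
  proof (rule cone_eq_0I)
    fix ys ws
    assume xs: "xs = x # ys @ [y]" "xs \<in> chains x y" and "length ws = Suc (length ys)"
      and lw: "last ws = clo (last (x # ys))"
    then have ws: "ws \<noteq> []"
      by auto
    note l = last_Cons_chain[OF xs(2)[unfolded xs(1)] subseq_order.order_refl]
    show "\<phi> (x # ws @ [y]) = 0"
    proof (rule ccontr)
      assume n: "\<phi> (x # ws @ [y]) \<noteq> 0"
      then have "clo (last ws) = y"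
        using assms(2) ws by (auto simp: critical_def butlast_append)
      with l lw have "last ws = y"
        by (simp add: clo_clo)
      moreover have "last ws \<sqsubset> y"
        using assms(1) n ws by (auto simp: chains_Cons_snoc_iff)
      ultimately show False
        by (simp add: lless_eq)
    qed
  qed
qed

text \<open>Deleting inner entries can only lower the last one, so by monotonicity of
  \<open>clo\<close> a chain with a critical face is critical itself.\<close>

lemma cobound_critical:
  assumes "critical \<phi>"
  shows "critical (cobound x y \<phi>)"
  unfolding critical_def
proof (intro allI impI, rule ccontr)
  fix xs
  assume n: "cobound x y \<phi> xs \<noteq> 0" and off: "clo (last (butlast xs)) \<noteq> y"
  have "cobound x y \<phi> xs = 0"
  proof (rule cobound_eq_0I)
    fix ys ws
    assume xs: "xs = x # ys @ [y]" "xs \<in> chains x y" and s: "subseq ws ys"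
    note l = last_Cons_chain[OF xs(2)[unfolded xs(1)] s]
    show "\<phi> (x # ws @ [y]) = 0"
    proof (rule ccontr)
      assume "\<phi> (x # ws @ [y]) \<noteq> 0"
      then have "clo (last (x # ws)) = y"
        using assms by (auto simp: critical_def butlast_append)
      moreover have "clo (last (x # ws)) \<sqsubseteq> clo (last (x # ys))"
        using l by (intro clo_mono)
      moreover have "clo (last (x # ys)) \<sqsubseteq> y" "clo (last (x # ys)) \<in> carrier L"
        using l a_le y_closed by (auto simp: lless_eq intro: clo_least clo_closed)
      ultimately have "clo (last (x # ys)) = y"
        using y_closed by (auto intro: le_antisym)
      with off show False
        by (simp add: xs(1) butlast_append)
    qed
  qed
  with n show False ..
qed

text \<open>Dropping y identifies critical cochains with families of cochains on the intervals
  [x,H]. Since y stands last, no sign arises.\<close>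

definition restr :: "'v \<Rightarrow> ('v list \<Rightarrow> 'k::comm_ring_1) \<Rightarrow> 'v list \<Rightarrow> 'k" where
  "restr H \<phi> xs = (if xs \<in> chains x H then \<phi> (xs @ [y]) else 0)"

lemma chain_to_coatom:
  assumes "H \<in> coatoms_off"
  shows "xs @ [y] \<in> chains x y \<and> xs \<noteq> [] \<and> last xs = H \<longleftrightarrow> xs \<in> chains x H"
proof (cases "xs = []")
  case False
  then show ?thesis
    using assms y_closed snoc_in_chains_iff[OF False, of y x]
    by (auto simp: coatoms_off_def chains_def)
qed (simp add: chains_def)

lemma chain_penultimate:
  assumes "xs \<in> chains x y" and "clo (last (butlast xs)) = y"
  obtains H \<tau> where "H \<in> coatoms_off" "\<tau> \<in> chains x H" "xs = \<tau> @ [y]"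
proof -
  obtain ys where xs: "xs = x # ys @ [y]"
    using assms(1) by (rule chain_obtain)
  note l = last_Cons_chain[OF assms(1)[unfolded xs] subseq_order.order_refl]
  have "last (x # ys) \<in> coatoms_off"
    using l assms(2) by (simp add: coatoms_off_def xs butlast_append)
  moreover from this have "x # ys \<in> chains x (last (x # ys))"
    using assms(1) chain_to_coatom[of "last (x # ys)" "x # ys"] by (simp add: xs)
  ultimately show ?thesis
    using that[of "last (x # ys)" "x # ys"] xs by simp
qed

lemma restr_coch: "H \<in> coatoms_off \<Longrightarrow> \<phi> \<in> coch x y n \<Longrightarrow> restr H \<phi> \<in> coch x H (n - 1)"
  unfolding coch_def
proof (intro CollectI allI impI)
  fix xs
  assume H: "H \<in> coatoms_off" and \<phi>: "\<phi> \<in> {\<phi>. \<forall>xs. \<phi> xs \<noteq> 0 \<longrightarrow> xs \<in> chains x y \<and> length xs = n}"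
    and "restr H \<phi> xs \<noteq> 0"
  then have "xs \<in> chains x H" "\<phi> (xs @ [y]) \<noteq> 0"
    unfolding restr_def by meson+
  with \<phi> show "xs \<in> chains x H \<and> length xs = n - 1"
    by force
qed

lemma restr_add: "restr H (\<phi> + \<psi>) = restr H \<phi> + restr H \<psi>"
  by (simp add: restr_def fun_eq_iff)

lemma restr_scale: "restr H (\<lambda>xs. c * \<phi> xs) = (\<lambda>xs. c * restr H \<phi> xs)"
  by (simp add: restr_def fun_eq_iff)

text \<open>All deletions from a chain x < ... < H < y except that of H take place inside [x,H].
  Deleting H contributes nothing: a nonzero value would make the new last inner element a member of
  \<open>coatoms_off\<close> strictly below H. Hence the direct sum has no mixed terms.\<close>

lemma restr_cobound:
  assumes "\<forall>xs. \<phi> xs \<noteq> 0 \<longrightarrow> xs \<in> chains x y" and "critical \<phi>" and H: "H \<in> coatoms_off"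
  shows "restr H (cobound x y \<phi>) = cobound x H (restr H \<phi>)"
proof
  fix \<tau>
  show "restr H (cobound x y \<phi>) \<tau> = cobound x H (restr H \<phi>) \<tau>"
  proof (cases "\<tau> \<in> chains x H")
    case True
    then have c: "\<tau> @ [y] \<in> chains x y"
      using chain_to_coatom[OF H] by blast
    show ?thesis
    proof (cases "H = x")
      case True
      with \<open>\<tau> \<in> chains x H\<close> have "\<tau> = [x]"
        using x_closed by (simp add: chains_self)
      then show ?thesis
        by (simp add: restr_def cobound_def)
    next
      case False
      then obtain zs where zs: "\<tau> = x # zs @ [H]"
        using \<open>\<tau> \<in> chains x H\<close> chains_ends by metis
      have c1: "x # zs @ [H] \<in> chains x H" and c2: "x # (zs @ [H]) @ [y] \<in> chains x y"
        using True c by (simp_all add: zs)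
      have "\<phi> (x # zs @ [y]) = 0"
      proof (rule ccontr)
        assume n: "\<phi> (x # zs @ [y]) \<noteq> 0"
        then have cz: "x # zs @ [y] \<in> chains x y"
          using assms(1) by blast
        note l = last_Cons_chain[OF cz subseq_order.order_refl]
        have "clo (last (x # zs)) = y"
          using n assms(2) by (auto simp: critical_def butlast_append)
        with l have "last (x # zs) \<in> coatoms_off"
          by (simp add: coatoms_off_def)
        moreover have "last (x # zs) \<sqsubset> H"
          using c1 snoc_in_chains_iff[of "x # zs" H x] by simp
        ultimately show False
          using H coatoms_off_incomparable by blast
      qed
      then have "cobound x y \<phi> (\<tau> @ [y]) = - alt_sum (\<lambda>ws. \<phi> (x # (ws @ [H]) @ [y])) zs"
        using cobound_Cons_snoc[OF c2, of \<phi>] by (simp add: zs alt_sum_snoc)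
      also have "alt_sum (\<lambda>ws. \<phi> (x # (ws @ [H]) @ [y])) zs =
          alt_sum (\<lambda>ws. restr H \<phi> (x # ws @ [H])) zs"
        using chains_subseq[OF c1] by (intro alt_sum_cong) (simp add: restr_def)
      also have "- \<dots> = cobound x H (restr H \<phi>) \<tau>"
        by (simp add: zs cobound_Cons_snoc[OF c1])
      finally show ?thesis
        using True by (simp add: restr_def)
    qed
  qed (simp add: restr_def cobound_def)
qed

end

section \<open>Contractions relative to a set of surviving chains\<close>

context ranked_semimodular_lattice
begin

text \<open>\<open>h\<close> is a contracting homotopy up to chains in \<open>I\<close> and vanishes on these; if they have top
  degree, their classes form a basis of the top cohomology.\<close>

definition contraction ::
    "'v \<Rightarrow> 'v \<Rightarrow> 'v list set \<Rightarrow> (('v list \<Rightarrow> 'k::comm_ring_1) \<Rightarrow> 'v list \<Rightarrow> 'k) \<Rightarrow> bool" where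
  "contraction x y I h \<longleftrightarrow>
     (\<forall>\<phi> \<psi>. h (\<phi> + \<psi>) = h \<phi> + h \<psi>) \<and>
     (\<forall>c \<phi>. h (\<lambda>xs. c * \<phi> xs) = (\<lambda>xs. c * h \<phi> xs)) \<and>
     (\<forall>n. \<forall>\<phi>\<in>coch x y n. h \<phi> \<in> coch x y (n - 1)) \<and>
     (\<forall>n. \<forall>\<phi>\<in>coch x y n. \<forall>xs\<in>chains x y - I.
        cobound x y (h \<phi>) xs + h (cobound x y \<phi>) xs = \<phi> xs) \<and>
     (\<forall>\<phi>. {xs. \<phi> xs \<noteq> 0} \<subseteq> I \<longrightarrow> h \<phi> = 0)"

lemma
  assumes "contraction x y I h"
  shows contraction_add: "h (\<phi> + \<psi>) = h \<phi> + h \<psi>"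
    and contraction_scale: "h (\<lambda>xs. c * \<phi> xs) = (\<lambda>xs. c * h \<phi> xs)"
    and contraction_coch: "\<phi> \<in> coch x y n \<Longrightarrow> h \<phi> \<in> coch x y (n - 1)"
    and contraction_homotopy: "\<phi> \<in> coch x y n \<Longrightarrow> xs \<in> chains x y - I \<Longrightarrow>
      cobound x y (h \<phi>) xs + h (cobound x y \<phi>) xs = \<phi> xs"
    and contraction_critical: "{xs. \<phi> xs \<noteq> 0} \<subseteq> I \<Longrightarrow> h \<phi> = 0"
proof -
  note * = assms[unfolded contraction_def]
  show "h (\<phi> + \<psi>) = h \<phi> + h \<psi>"
    using * by (elim conjE allE)
  show "h (\<lambda>xs. c * \<phi> xs) = (\<lambda>xs. c * h \<phi> xs)"
    using conjunct1[OF conjunct2[OF *]] by (elim allE)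
  show "\<phi> \<in> coch x y n \<Longrightarrow> h \<phi> \<in> coch x y (n - 1)"
    by (rule conjunct1[OF conjunct2[OF conjunct2[OF *]], rule_format])
  show "\<phi> \<in> coch x y n \<Longrightarrow> xs \<in> chains x y - I \<Longrightarrow>
      cobound x y (h \<phi>) xs + h (cobound x y \<phi>) xs = \<phi> xs"
    by (rule conjunct1[OF conjunct2[OF conjunct2[OF conjunct2[OF *]]], rule_format])
  show "{xs. \<phi> xs \<noteq> 0} \<subseteq> I \<Longrightarrow> h \<phi> = 0"
    by (rule conjunct2[OF conjunct2[OF conjunct2[OF conjunct2[OF *]]], rule_format])
qed

lemma contraction_self:
  "x \<in> carrier L \<Longrightarrow> contraction x x {[x]} (\<lambda>\<phi>. 0)"
  by (simp add: contraction_def chains_self fun_eq_iff)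

end

text \<open>Write d for \<open>cobound x y\<close>. Then p = 1 - d cone - cone d is a chain map into
  the critical subcomplex, and g acts as \<open>h H\<close> on the summand of H. In cone + g p the
  first term accounts for 1 - p and the second, off J, for p. A cochain supported on J is critical,
  so \<open>cone\<close> kills it and its coboundary; thus p fixes it, and g kills it because each
  \<open>h H\<close> vanishes on \<open>I H\<close>.\<close>

lemma (in interval_atom) contraction_step:
  fixes h :: "'v \<Rightarrow> ('v list \<Rightarrow> 'k::comm_ring_1) \<Rightarrow> 'v list \<Rightarrow> 'k"
  assumes h: "\<And>H. H \<in> coatoms_off \<Longrightarrow> contraction x H (I H) (h H)"
    and I: "\<And>H. H \<in> coatoms_off \<Longrightarrow> I H \<subseteq> chains x H"
  shows "\<exists>h' :: ('v list \<Rightarrow> 'k) \<Rightarrow> 'v list \<Rightarrow> 'k.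
    contraction x y (\<Union>H\<in>coatoms_off. (\<lambda>\<tau>. \<tau> @ [y]) ` I H) h'"
proof -
  define J where "J = (\<Union>H\<in>coatoms_off. (\<lambda>\<tau>. \<tau> @ [y]) ` I H)"
  define g where "g \<phi> xs = (if xs \<in> chains x y \<and> clo (last (butlast xs)) = y
    then h (last (butlast xs)) (restr (last (butlast xs)) \<phi>) (butlast xs) else 0)"
    for \<phi> :: "'v list \<Rightarrow> 'k" and xs
  define p where "p \<phi> = \<phi> - cobound x y (cone \<phi>) - cone (cobound x y \<phi>)" for \<phi> :: "'v list \<Rightarrow> 'k"
  note h_add = contraction_add[OF h] and h_scale = contraction_scale[OF h]
    and h_coch = contraction_coch[OF h] and h_homotopy = contraction_homotopy[OF h]
    and h_I = contraction_critical[OF h]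
  have g_snoc: "g \<phi> (\<tau> @ [y]) = h H (restr H \<phi>) \<tau>" if "H \<in> coatoms_off" "\<tau> \<in> chains x H" for H \<tau> \<phi>
    using that chain_to_coatom[OF that(1), of \<tau>] by (auto simp: g_def coatoms_off_def)
  have g_0: "g \<phi> xs = 0" if "\<And>H \<tau>. H \<in> coatoms_off \<Longrightarrow> \<tau> \<in> chains x H \<Longrightarrow> xs = \<tau> @ [y] \<Longrightarrow>
      h H (restr H \<phi>) \<tau> = 0" for \<phi> xs
  proof (cases "xs \<in> chains x y \<and> clo (last (butlast xs)) = y")
    case True
    then obtain H \<tau> where "H \<in> coatoms_off" "\<tau> \<in> chains x H" "xs = \<tau> @ [y]"
      using chain_penultimate by blast
    with that show ?thesis
      using g_snoc by simp
  qed (auto simp: g_def)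
  have g_add: "g (\<phi> + \<psi>) = g \<phi> + g \<psi>" for \<phi> \<psi>
  proof
    fix xs
    show "g (\<phi> + \<psi>) xs = (g \<phi> + g \<psi>) xs"
    proof (cases "xs \<in> chains x y \<and> clo (last (butlast xs)) = y")
      case True
      then obtain H \<tau> where "H \<in> coatoms_off" "\<tau> \<in> chains x H" "xs = \<tau> @ [y]"
        using chain_penultimate by blast
      then show ?thesis
        by (simp add: g_snoc restr_add h_add)
    qed (auto simp: g_def)
  qed
  have g_scale: "g (\<lambda>xs. c * \<phi> xs) = (\<lambda>xs. c * g \<phi> xs)" for c \<phi>
  proof
    fix xs
    show "g (\<lambda>xs. c * \<phi> xs) xs = c * g \<phi> xs"
    proof (cases "xs \<in> chains x y \<and> clo (last (butlast xs)) = y")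
      case True
      then obtain H \<tau> where "H \<in> coatoms_off" "\<tau> \<in> chains x H" "xs = \<tau> @ [y]"
        using chain_penultimate by blast
      then show ?thesis
        by (simp add: g_snoc restr_scale h_scale)
    qed (auto simp: g_def)
  qed
  have g_coch: "g \<phi> \<in> coch x y (n - 1)" if "\<phi> \<in> coch x y n" for \<phi> n
    unfolding coch_def
  proof (intro CollectI allI impI)
    fix xs
    assume n: "g \<phi> xs \<noteq> 0"
    then have c: "xs \<in> chains x y \<and> clo (last (butlast xs)) = y"
      unfolding g_def by meson
    then obtain H \<tau> where H: "H \<in> coatoms_off" "\<tau> \<in> chains x H" "xs = \<tau> @ [y]"
      using chain_penultimate by blast
    have *: "h H (restr H \<phi>) \<in> coch x H (n - 1 - 1)"
      using H that by (intro h_coch restr_coch)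
    have "h H (restr H \<phi>) \<tau> \<noteq> 0"
      using n H g_snoc by simp
    with * have "length \<tau> = n - 1 - 1"
      using coch_nonzeroD by blast
    moreover have "\<tau> \<noteq> []"
      using H(2) by (simp add: chains_def)
    ultimately show "xs \<in> chains x y \<and> length xs = n - 1"
      using c H(3) by (cases \<tau>) auto
  qed
  have g_critical: "critical (g \<phi>)" for \<phi>
    unfolding critical_def g_def by meson
  \<comment> \<open>\<open>cobound\<close> after \<open>cone\<close> ends in length
    \<open>Suc (n - 1)\<close>, which is n only for n > 0. For n = 0 there are no nonzero cochains,
    as chains are nonempty.\<close>
  have p_coch: "p \<phi> \<in> coch x y n" if "\<phi> \<in> coch x y n" for \<phi> n
  proof (cases n)
    case 0
    with that have "\<phi> = 0"
      using coch_0 by blast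
    then show ?thesis
      by (simp add: p_def cobound_zero cone_zero)
  next
    case (Suc m)
    with that cone_coch[OF that] cone_coch[OF cobound_coch[OF that]] show ?thesis
      unfolding p_def by (intro coch_diff) (auto dest: cobound_coch)
  qed
  have p_critical: "critical (p \<phi>)" if "\<phi> \<in> coch x y n" for \<phi> n
    unfolding critical_def
  proof (intro allI impI, rule ccontr)
    fix xs
    assume n: "p \<phi> xs \<noteq> 0" and off: "clo (last (butlast xs)) \<noteq> y"
    from n have "xs \<in> chains x y"
      using coch_nonzeroD[OF p_coch[OF that]] by blast
    from cone_homotopy[OF that this off] n show False
      by (simp add: p_def algebra_simps)
  qed
  have p_cobound: "p (cobound x y \<phi>) = cobound x y (p \<phi>)" for \<phi>
    by (simp add: p_def cobound_diff cobound_cobound cone_zero)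
  have p_add: "p (\<phi> + \<psi>) = p \<phi> + p \<psi>" for \<phi> \<psi>
    by (simp add: p_def cobound_add cone_add)
  have p_scale: "p (\<lambda>xs. c * \<phi> xs) = (\<lambda>xs. c * p \<phi> xs)" for c \<phi>
    by (simp add: p_def fun_eq_iff cobound_scale cone_scale right_diff_distrib)
  have g_homotopy: "cobound x y (g \<phi>) xs + g (cobound x y \<phi>) xs = \<phi> xs"
    if \<phi>: "\<phi> \<in> coch x y n" "critical \<phi>" and xs: "xs \<in> chains x y - J" for \<phi> n xs
  proof (cases "clo (last (butlast xs)) = y")
    case True
    with xs obtain H \<tau> where H: "H \<in> coatoms_off" "\<tau> \<in> chains x H" "xs = \<tau> @ [y]"
      using chain_penultimate by blast
    have supp: "\<forall>xs. \<phi> xs \<noteq> 0 \<longrightarrow> xs \<in> chains x y"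
      using \<phi>(1) coch_nonzeroD by blast
    have supp_g: "\<forall>xs. g \<phi> xs \<noteq> 0 \<longrightarrow> xs \<in> chains x y"
      unfolding g_def by meson
    have res: "restr H (g \<phi>) = h H (restr H \<phi>)"
    proof
      fix \<sigma>
      have "h H (restr H \<phi>) \<sigma> = 0" if "\<sigma> \<notin> chains x H"
        using that coch_eq_0[OF h_coch[OF H(1) restr_coch[OF H(1) \<phi>(1)]]] by blast
      then show "restr H (g \<phi>) \<sigma> = h H (restr H \<phi>) \<sigma>"
        using g_snoc[OF H(1)] by (cases "\<sigma> \<in> chains x H") (simp_all add: restr_def)
    qed
    have "cobound x y (g \<phi>) xs = restr H (cobound x y (g \<phi>)) \<tau>"
      using H by (simp add: restr_def)
    also have "\<dots> = cobound x H (h H (restr H \<phi>)) \<tau>"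
      by (simp only: restr_cobound[OF supp_g g_critical H(1)] res)
    finally have 1: "cobound x y (g \<phi>) xs = cobound x H (h H (restr H \<phi>)) \<tau>" .
    have 2: "g (cobound x y \<phi>) xs = h H (cobound x H (restr H \<phi>)) \<tau>"
      by (simp only: H(3) g_snoc[OF H(1,2)] restr_cobound[OF supp \<phi>(2) H(1)])
    have "\<tau> \<in> chains x H - I H"
      using xs H unfolding J_def by blast
    then have "cobound x H (h H (restr H \<phi>)) \<tau> + h H (cobound x H (restr H \<phi>)) \<tau> = \<phi> xs"
      by (simp only: h_homotopy[OF H(1) restr_coch[OF H(1) \<phi>(1)]]) (simp add: restr_def H)
    then show ?thesis
      by (simp only: 1 2)
  next
    case False
    then have "\<phi> xs = 0" "cobound x y (g \<phi>) xs = 0" "g (cobound x y \<phi>) xs = 0"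
      using \<phi>(2) cobound_critical[OF g_critical[of \<phi>]] g_critical[of "cobound x y \<phi>"]
      unfolding critical_def by blast+
    then show ?thesis
      by simp
  qed
  define h' where "h' \<phi> = cone \<phi> + g (p \<phi>)" for \<phi>
  have "h' (\<phi> + \<psi>) = h' \<phi> + h' \<psi>" for \<phi> \<psi>
    by (simp add: h'_def cone_add p_add g_add)
  moreover have "h' (\<lambda>xs. c * \<phi> xs) = (\<lambda>xs. c * h' \<phi> xs)" for c \<phi>
    by (simp add: h'_def fun_eq_iff cone_scale p_scale g_scale distrib_left)
  moreover have "h' \<phi> \<in> coch x y (n - 1)" if "\<phi> \<in> coch x y n" for \<phi> n
    unfolding h'_def using that by (intro coch_add cone_coch g_coch p_coch)
  moreover have "cobound x y (h' \<phi>) xs + h' (cobound x y \<phi>) xs = \<phi> xs"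
    if "\<phi> \<in> coch x y n" "xs \<in> chains x y - J" for \<phi> n xs
  proof -
    have "cobound x y (h' \<phi>) xs + h' (cobound x y \<phi>) xs =
        cobound x y (cone \<phi>) xs + cone (cobound x y \<phi>) xs +
        (cobound x y (g (p \<phi>)) xs + g (cobound x y (p \<phi>)) xs)"
      by (simp add: h'_def cobound_add p_cobound)
    also have "cobound x y (g (p \<phi>)) xs + g (cobound x y (p \<phi>)) xs = p \<phi> xs"
      using that by (intro g_homotopy p_coch p_critical)
    finally show ?thesis
      by (simp add: p_def)
  qed
  moreover have "h' \<phi> = 0" if supp: "{xs. \<phi> xs \<noteq> 0} \<subseteq> J" for \<phi>
  proof -
    have J: "\<exists>H\<in>coatoms_off. \<exists>\<tau>\<in>I H. xs = \<tau> @ [y]" if "\<phi> xs \<noteq> 0" for xs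
      using that supp unfolding J_def by blast
    have chains: "\<forall>xs. \<phi> xs \<noteq> 0 \<longrightarrow> xs \<in> chains x y"
      using J I chain_to_coatom by blast
    have crit: "critical \<phi>"
      unfolding critical_def
    proof (intro allI impI)
      fix xs
      assume "\<phi> xs \<noteq> 0"
      then obtain H \<tau> where "H \<in> coatoms_off" "\<tau> \<in> I H" "xs = \<tau> @ [y]"
        using J by blast
      moreover from this have "last \<tau> = H"
        using I by (auto simp: chains_def)
      ultimately show "clo (last (butlast xs)) = y"
        by (simp add: coatoms_off_def)
    qed
    have "\<forall>xs. cobound x y \<phi> xs \<noteq> 0 \<longrightarrow> xs \<in> chains x y"
      by (simp add: cobound_def)
    then have "p \<phi> = \<phi>"
      by (simp add: p_def cone_critical chains crit cobound_critical cobound_zero)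
    moreover have "g \<phi> = 0"
    proof
      fix xs
      have "h H (restr H \<phi>) = 0" if H: "H \<in> coatoms_off" for H
      proof (rule h_I[OF H], rule subsetI)
        fix \<tau>
        assume "\<tau> \<in> {xs. restr H \<phi> xs \<noteq> 0}"
        then have "\<tau> \<in> chains x H" "\<phi> (\<tau> @ [y]) \<noteq> 0"
          by (auto simp: restr_def split: if_splits)
        with J obtain H' where "H' \<in> coatoms_off" "\<tau> \<in> I H'"
          by fastforce
        with I \<open>\<tau> \<in> chains x H\<close> show "\<tau> \<in> I H"
          by (auto simp: chains_def)
      qed
      then show "g \<phi> xs = 0 xs"
        unfolding zero_fun_def by (intro g_0) simp
    qed
    ultimately show ?thesis
      by (simp add: h'_def cone_critical chains crit)
  qed
  ultimately have "contraction x y J h'"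
    unfolding contraction_def by blast
  then show ?thesis
    unfolding J_def by blast
qed

section \<open>Rank, saturated chains and the induction over intervals\<close>

context ranked_semimodular_lattice
begin

lemma ex_cover:
  assumes "x \<in> carrier L" and "y \<in> carrier L" and "x \<sqsubset> y"
  obtains a where "covered L x a" and "a \<sqsubseteq> y"
proof -
  define P where "P z \<longleftrightarrow> z \<in> carrier L \<and> x \<sqsubset> z \<and> z \<sqsubseteq> y" for z
  have "P y"
    using assms by (simp add: P_def)
  then obtain a where a: "P a"
    and least: "\<And>z. P z \<Longrightarrow> card {w \<in> carrier L. w \<sqsubseteq> a} \<le> card {w \<in> carrier L. w \<sqsubseteq> z}"
    using ex_has_least_nat[of P y "\<lambda>z. card {w \<in> carrier L. w \<sqsubseteq> z}"] by blast
  have "\<not> z \<sqsubset> a" if z: "z \<in> carrier L" "x \<sqsubset> z" for z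
  proof
    assume "z \<sqsubset> a"
    with z a have "P z" "{w \<in> carrier L. w \<sqsubseteq> z} \<subseteq> {w \<in> carrier L. w \<sqsubseteq> a}"
      using assms(2) unfolding P_def lless_eq by (blast intro: le_trans)+
    moreover have "a \<notin> {w \<in> carrier L. w \<sqsubseteq> z}" "a \<in> {w \<in> carrier L. w \<sqsubseteq> a}"
      using \<open>z \<sqsubset> a\<close> z a unfolding P_def lless_eq by (auto intro: le_antisym)
    ultimately have "{w \<in> carrier L. w \<sqsubseteq> z} \<subset> {w \<in> carrier L. w \<sqsubseteq> a}"
      by blast
    then have "card {w \<in> carrier L. w \<sqsubseteq> z} < card {w \<in> carrier L. w \<sqsubseteq> a}"
      using finite_carrier by (intro psubset_card_mono) auto
    with least[OF \<open>P z\<close>] show False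
      by simp
  qed
  with a assms(1) have "covered L x a" "a \<sqsubseteq> y"
    unfolding P_def covered_def by blast+
  then show ?thesis
    by (rule that)
qed

text \<open>The chain is built upwards by covers, by induction on the number of elements above x.
  The rank inequalities come along because \<open>rk\<close> is given on covers only and
  \<open>rk y - rk x\<close> is truncated.\<close>

lemma ex_saturated_chain:
  assumes "x \<in> carrier L" and "y \<in> carrier L" and "x \<sqsubseteq> y"
  shows "rk x \<le> rk y \<and> (x \<noteq> y \<longrightarrow> rk x < rk y) \<and> (\<exists>xs\<in>chains x y. length xs = Suc (rk y - rk x))"
  using assms
proof (induction "card {z \<in> carrier L. x \<sqsubset> z}" arbitrary: x rule: less_induct)
  case less
  show ?case
  proof (cases "x = y")
    case True
    with less.prems show ?thesis
      by (simp add: chains_self)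
  next
    case False
    with less.prems obtain a where a: "covered L x a" "a \<sqsubseteq> y"
      using ex_cover[of x y] by (auto simp: lless_eq)
    then have ac: "a \<in> carrier L" "x \<sqsubset> a"
      by (auto simp: covered_def)
    have "{z \<in> carrier L. a \<sqsubset> z} \<subseteq> {z \<in> carrier L. x \<sqsubset> z}"
      using ac less.prems by (auto intro: lless_trans[of x a])
    moreover have "a \<notin> {z \<in> carrier L. a \<sqsubset> z}" "a \<in> {z \<in> carrier L. x \<sqsubset> z}"
      using ac by (auto simp: not_lless_self)
    ultimately have "{z \<in> carrier L. a \<sqsubset> z} \<subset> {z \<in> carrier L. x \<sqsubset> z}"
      by blast
    then have "card {z \<in> carrier L. a \<sqsubset> z} < card {z \<in> carrier L. x \<sqsubset> z}"
      using finite_carrier by (intro psubset_card_mono) auto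
    from less.hyps[OF this ac(1) less.prems(2) a(2)]
    obtain xs where xs: "rk a \<le> rk y" "xs \<in> chains a y" "length xs = Suc (rk y - rk a)"
      by blast
    have "x \<sqsubset> z" if "z \<in> set xs" for z
    proof -
      have "a \<sqsubseteq> z" "z \<in> carrier L"
        using xs(2) that chain_first_le[OF xs(2)] by (auto simp: chains_def)
      with ac less.prems(1) show ?thesis
        by (cases "a = z") (simp_all add: lless_trans[of x a z] lless_eq[of a z])
    qed
    then have "x # xs \<in> chains x y"
      using xs(2) less.prems(1) by (auto simp: chains_def)
    moreover have "length (x # xs) = Suc (rk y - rk x)" "rk x < rk y"
      using xs(1,3) rk_covered[OF a(1)] by auto
    ultimately show ?thesis
      by (auto intro!: bexI[of _ "x # xs"])
  qed
qed

lemma rk_strict_mono: "x \<in> carrier L \<Longrightarrow> y \<in> carrier L \<Longrightarrow> x \<sqsubset> y \<Longrightarrow> rk x < rk y"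
  using ex_saturated_chain[of x y] by (simp add: lless_eq)

lemma length_chain_le:
  assumes "xs \<in> chains x y"
  shows "rk x + length xs \<le> Suc (rk y)"
proof -
  have "rk (hd xs) + length xs \<le> Suc (rk (last xs))"
    if "xs \<noteq> []" "set xs \<subseteq> carrier L" "sorted_wrt (\<sqsubset>) xs"
    using that
  proof (induction xs rule: induct_list012)
    case (3 x z zs)
    then have "rk x < rk z"
      by (intro rk_strict_mono) auto
    with 3 show ?case
      by simp
  qed simp_all
  with assms show ?thesis
    by (auto simp: chains_def)
qed

definition maximal_chains :: "'v \<Rightarrow> 'v \<Rightarrow> 'v list set" where
  "maximal_chains x y = {xs \<in> chains x y. length xs = Suc (rk y - rk x)}"

lemma finite_maximal_chains: "finite (maximal_chains x y)"
proof (rule finite_subset)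
  show "maximal_chains x y \<subseteq> {xs. set xs \<subseteq> carrier L \<and> length xs = Suc (rk y - rk x)}"
    by (auto simp: maximal_chains_def chains_def)
qed (simp add: finite_carrier finite_lists_length_eq)

text \<open>\<open>m\<close> will be the rank of the top cohomology. Placing I among the maximal
  chains confines the failure of the contraction to the top degree.\<close>

definition spherical :: "'k::comm_ring_1 itself \<Rightarrow> 'v \<Rightarrow> 'v \<Rightarrow> nat \<Rightarrow> bool" where
  "spherical K x y m \<longleftrightarrow> (\<exists>I (h :: ('v list \<Rightarrow> 'k) \<Rightarrow> 'v list \<Rightarrow> 'k).
     I \<subseteq> maximal_chains x y \<and> card I = m \<and> contraction x y I h)"

lemma spherical_self: "x \<in> carrier L \<Longrightarrow> spherical K x x 1"
  unfolding spherical_def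
  by (rule exI[of _ "{[x]}"], rule exI[of _ "\<lambda>\<phi>. 0"])
    (simp add: contraction_self maximal_chains_def chains_self)

end

text \<open>Appending y keeps a chain maximal because y covers H, and H can be read off as the
  penultimate entry, so the sets for different H are disjoint and their sizes add up.\<close>

lemma (in interval_atom) spherical_step:
  assumes "\<And>H. H \<in> coatoms_off \<Longrightarrow> spherical TYPE('k::comm_ring_1) x H (m H)"
  shows "spherical TYPE('k) x y (\<Sum>H\<in>coatoms_off. m H)"
proof -
  have "\<exists>I h. I \<subseteq> maximal_chains x H \<and> card I = m H \<and>
      contraction x H I (h :: ('v list \<Rightarrow> 'k) \<Rightarrow> 'v list \<Rightarrow> 'k)" if "H \<in> coatoms_off" for H
    using assms[OF that] by (simp add: spherical_def)
  then obtain I and h :: "'v \<Rightarrow> ('v list \<Rightarrow> 'k) \<Rightarrow> 'v list \<Rightarrow> 'k"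
    where I: "\<And>H. H \<in> coatoms_off \<Longrightarrow> I H \<subseteq> maximal_chains x H"
      "\<And>H. H \<in> coatoms_off \<Longrightarrow> card (I H) = m H"
      and h: "\<And>H. H \<in> coatoms_off \<Longrightarrow> contraction x H (I H) (h H)"
    by metis
  have sub: "I H \<subseteq> chains x H" if "H \<in> coatoms_off" for H
    using I(1)[OF that] by (auto simp: maximal_chains_def)
  define J where "J = (\<Union>H\<in>coatoms_off. (\<lambda>\<tau>. \<tau> @ [y]) ` I H)"
  obtain h' :: "('v list \<Rightarrow> 'k) \<Rightarrow> 'v list \<Rightarrow> 'k" where "contraction x y J h'"
    using contraction_step[of I h, OF h sub] unfolding J_def by blast
  moreover have "J \<subseteq> maximal_chains x y"
  proof
    fix xs
    assume "xs \<in> J"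
    then obtain H \<tau> where H: "H \<in> coatoms_off" "\<tau> \<in> I H" "xs = \<tau> @ [y]"
      unfolding J_def by blast
    have "rk y = Suc (rk H)"
      using coatoms_off_covered[OF H(1)] by (rule rk_covered)
    moreover have "rk x \<le> rk H"
      using H(1) x_closed ex_saturated_chain[of x H] by (simp add: coatoms_off_def)
    moreover have "\<tau> \<in> chains x H" "length \<tau> = Suc (rk H - rk x)"
      using I(1)[OF H(1)] H(2) by (auto simp: maximal_chains_def)
    moreover from this have "xs \<in> chains x y"
      using chain_to_coatom[OF H(1)] H(3) by blast
    ultimately show "xs \<in> maximal_chains x y"
      using H(3) by (simp add: maximal_chains_def Suc_diff_le)
  qed
  moreover have "card J = (\<Sum>H\<in>coatoms_off. m H)"
  proof -
    have "card J = (\<Sum>H\<in>coatoms_off. card ((\<lambda>\<tau>. \<tau> @ [y]) ` I H))"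
      unfolding J_def
    proof (rule card_UN_disjoint)
      show "finite coatoms_off"
        using finite_carrier by (simp add: coatoms_off_def)
      show "\<forall>H\<in>coatoms_off. finite ((\<lambda>\<tau>. \<tau> @ [y]) ` I H)"
        by (intro ballI finite_imageI finite_subset[OF I(1) finite_maximal_chains])
      show "\<forall>H\<in>coatoms_off. \<forall>H'\<in>coatoms_off. H \<noteq> H' \<longrightarrow>
          (\<lambda>\<tau>. \<tau> @ [y]) ` I H \<inter> (\<lambda>\<tau>. \<tau> @ [y]) ` I H' = {}"
      proof (intro ballI impI equals0I)
        fix H H' xs
        assume "H \<in> coatoms_off" "H' \<in> coatoms_off" "H \<noteq> H'"
          "xs \<in> (\<lambda>\<tau>. \<tau> @ [y]) ` I H \<inter> (\<lambda>\<tau>. \<tau> @ [y]) ` I H'"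
        then obtain \<tau> where "\<tau> \<in> chains x H" "\<tau> \<in> chains x H'"
          using sub[of H] sub[of H'] by blast
        with \<open>H \<noteq> H'\<close> show False
          by (simp add: chains_def)
      qed
    qed
    also have "\<dots> = (\<Sum>H\<in>coatoms_off. m H)"
      using I(2) by (intro sum.cong) (auto simp: card_image inj_on_def)
    finally show ?thesis .
  qed
  ultimately show ?thesis
    unfolding spherical_def by blast
qed

text \<open>With x fixed, any cover of x below y drives the induction, since each H in
  \<open>coatoms_off\<close> has smaller rank than y.\<close>

lemma (in ranked_semimodular_lattice) ex_spherical:
  assumes "x \<in> carrier L" and "y \<in> carrier L" and "x \<sqsubseteq> y"
  shows "\<exists>m. spherical TYPE('k::comm_ring_1) x y m"
  using assms(2,3)
proof (induction "rk y" arbitrary: y rule: less_induct)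
  case less
  show ?case
  proof (cases "x = y")
    case True
    then show ?thesis
      using assms(1) spherical_self by blast
  next
    case False
    with less.prems obtain a where a: "covered L x a" "a \<sqsubseteq> y"
      using ex_cover[OF assms(1), of y] by (auto simp: lless_eq)
    interpret interval_atom L rk x y a
      by unfold_locales (use a less.prems in auto)
    have "\<exists>m. spherical TYPE('k) x H m" if "H \<in> coatoms_off" for H
      using that less.prems by (intro less.hyps rk_strict_mono) (auto simp: coatoms_off_def)
    then obtain m where "\<And>H. H \<in> coatoms_off \<Longrightarrow> spherical TYPE('k) x H (m H)"
      by metis
    then have "spherical TYPE('k) x y (\<Sum>H\<in>coatoms_off. m H)"
      by (rule spherical_step)
    then show ?thesis
      by blast
  qed
qed

lemma (in ranked_semimodular_lattice) graded: "graded_poset L"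
proof -
  have "rk (last xs) + 1 = rk (hd xs) + length xs" if "xs \<noteq> []" "successively (covered L) xs" for xs
    using that
  proof (induction xs rule: induct_list012)
    case (3 x y zs)
    then show ?case
      using rk_covered[of x y] by simp
  qed simp_all
  then have "length xs = length ys" if "xs \<noteq> []" "ys \<noteq> []" "successively (covered L) xs"
      "successively (covered L) ys" "hd xs = hd ys" "last xs = last ys" for xs ys
    using that by (metis add_left_imp_eq)
  then show ?thesis
    unfolding graded_poset_def using partial_order_axioms finite_carrier by blast
qed

section \<open>Modules of cochains and their subquotients\<close>

lemma lookup_scale [simp]: "Poly_Mapping.lookup (scale c f) xs = c * Poly_Mapping.lookup f xs"
  by (simp add: scale_def map.rep_eq when_def)

lemma scale_add_left: "scale (c + c') f = scale c f + scale c' f"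
  by (rule poly_mapping_eqI) (simp add: lookup_add distrib_right)

lemma scale_zero_left [simp]: "scale 0 f = 0"
  by (rule poly_mapping_eqI) simp

lemma cochains_iff:
  "f \<in> cochains P n \<longleftrightarrow> (\<forall>xs. Poly_Mapping.lookup f xs \<noteq> 0 \<longrightarrow> xs \<in> spanning_chains P n)"
  by (auto simp: cochains_def in_keys_iff)

lemma cochains_zero [simp]: "0 \<in> cochains P n"
  by (simp add: cochains_def)

lemma cochains_add: "f \<in> cochains P n \<Longrightarrow> g \<in> cochains P n \<Longrightarrow> f + g \<in> cochains P n"
  by (simp add: cochains_iff lookup_add) (metis add.right_neutral)

lemma cochains_diff: "f \<in> cochains P n \<Longrightarrow> g \<in> cochains P n \<Longrightarrow> f - g \<in> cochains P n"
  by (simp add: cochains_iff lookup_minus) metis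

lemma cochains_scale: "f \<in> cochains P n \<Longrightarrow> scale c f \<in> cochains P n"
  by (simp add: cochains_iff) (metis mult_zero_right)

lemma differential_superset:
  assumes "finite A" and "Poly_Mapping.keys f \<subseteq> A"
  shows "differential P f = (\<Sum>xs\<in>A. scale (Poly_Mapping.lookup f xs) (d_symbol P xs))"
  unfolding differential_def
  by (rule sum.mono_neutral_left) (use assms in \<open>auto simp: in_keys_iff\<close>)

lemma differential_add: "differential P (f + g) = differential P f + differential P g"
proof -
  have "finite (Poly_Mapping.keys f \<union> Poly_Mapping.keys g)"
    by simp
  note * = differential_superset[OF this]
  show ?thesis
    using *[of f] *[of g] *[of "f + g"] Poly_Mapping.keys_add[of f g]
    by (simp add: lookup_add scale_add_left sum.distrib)
qed

lemma differential_zero [simp]: "differential P 0 = 0"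
  by (simp add: differential_def)

lemma differential_diff: "differential P (f - g) = differential P f - differential P g"
  using differential_add[of P "f - g" g] by (simp add: eq_diff_eq)

lemma is_singleton_subquotient:
  assumes "0 \<in> Z" and "\<And>u v. u \<in> Z \<Longrightarrow> v \<in> Z \<Longrightarrow> u - v \<in> B"
  shows "is_singleton (subquotient Z B)"
proof (rule is_singletonI')
  show "subquotient Z B \<noteq> {}"
    using assms(1) by (auto simp: subquotient_def quotient_def)
  show "A = A'" if "A \<in> subquotient Z B" "A' \<in> subquotient Z B" for A A'
    using that assms(2) unfolding subquotient_def quotient_def mod_rel_def by auto
qed

lemma mod_rel_eq_iff:
  assumes "0 \<in> B" and "\<And>b b'. b \<in> B \<Longrightarrow> b' \<in> B \<Longrightarrow> b - b' \<in> B" and "u \<in> Z" and "v \<in> Z"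
  shows "mod_rel Z B `` {u} = mod_rel Z B `` {v} \<longleftrightarrow> u - v \<in> B"
proof
  assume "mod_rel Z B `` {u} = mod_rel Z B `` {v}"
  moreover have "v \<in> mod_rel Z B `` {v}"
    using assms by (simp add: mod_rel_def)
  ultimately show "u - v \<in> B"
    by (auto simp: mod_rel_def)
next
  assume uv: "u - v \<in> B"
  have "u - w \<in> B \<longleftrightarrow> v - w \<in> B" for w
  proof
    assume "u - w \<in> B"
    from assms(2)[OF this uv] show "v - w \<in> B"
      by simp
  next
    assume "v - w \<in> B"
    from assms(2)[OF this assms(2)[OF assms(1) uv]] show "u - w \<in> B"
      by simp
  qed
  with assms(3,4) show "mod_rel Z B `` {u} = mod_rel Z B `` {v}"
    by (auto simp: mod_rel_def)
qed

section \<open>Cohomology and dual homology from a contraction up to top-degree chains\<close>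

locale top_contraction =
  fixes P :: "'v gorder" and r :: nat and J :: "'v list set"
    and H :: "('v list \<Rightarrow>\<^sub>0 'k::comm_ring_1) \<Rightarrow> ('v list \<Rightarrow>\<^sub>0 'k)"
  assumes finite_J: "finite J" and J_subset: "J \<subseteq> spanning_chains P r"
    and no_chains: "\<And>n. r < n \<Longrightarrow> spanning_chains P n = {}"
    and differential_cochains: "\<And>n f. f \<in> cochains P n \<Longrightarrow>
      differential P f \<in> (cochains P (Suc n) :: ('v list \<Rightarrow>\<^sub>0 'k) set)"
    and differential_differential: "\<And>n f. f \<in> cochains P n \<Longrightarrow>
      differential P (differential P f) = (0 :: 'v list \<Rightarrow>\<^sub>0 'k)"
    and H_0: "\<And>f. f \<in> cochains P 0 \<Longrightarrow> H f = 0"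
    and H_cochains: "\<And>n f. f \<in> cochains P (Suc n) \<Longrightarrow> H f \<in> cochains P n"
    and H_add: "\<And>n f g. f \<in> cochains P n \<Longrightarrow> g \<in> cochains P n \<Longrightarrow> H (f + g) = H f + H g"
    and H_scale: "\<And>n c f. f \<in> cochains P n \<Longrightarrow> H (scale c f) = scale c (H f)"
    and H_homotopy: "\<And>n f. f \<in> cochains P n \<Longrightarrow>
      Poly_Mapping.keys (f - (differential P (H f) + H (differential P f))) \<subseteq> J"
    and H_J: "\<And>f. Poly_Mapping.keys f \<subseteq> J \<Longrightarrow> H f = 0"
begin

lemma cochains_above: "r < n \<Longrightarrow> f \<in> cochains P n \<Longrightarrow> f = 0"
  by (simp add: cochains_def no_chains)

lemma H_zero [simp]: "H 0 = 0"
  by (rule H_J) simp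

lemma spanning_chains_disjoint: "n \<noteq> m \<Longrightarrow> spanning_chains P n \<inter> spanning_chains P m = {}"
  by (auto simp: spanning_chains_def)

lemma dH_cochains: "f \<in> cochains P n \<Longrightarrow> differential P (H f) \<in> cochains P n"
  by (cases n) (auto simp: H_0 intro: differential_cochains H_cochains)

text \<open>J consists of chains of degree r, so in lower degrees the error term of
  \<open>H_homotopy\<close> has empty support.\<close>

lemma homotopy:
  assumes "n < r" and f: "f \<in> cochains P n"
  shows "differential P (H f) + H (differential P f) = f"
proof -
  let ?g = "f - (differential P (H f) + H (differential P f))"
  have "?g \<in> cochains P n"
    using f by (intro cochains_diff cochains_add dH_cochains H_cochains differential_cochains)
  then have "Poly_Mapping.keys ?g \<subseteq> spanning_chains P n \<inter> J"
    using H_homotopy[OF f] by (simp add: cochains_def)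
  also have "\<dots> \<subseteq> {}"
    using J_subset spanning_chains_disjoint[of n r] assms(1) by auto
  finally show ?thesis
    by simp
qed

lemma coboundaries_zero: "(0 :: 'v list \<Rightarrow>\<^sub>0 'k) \<in> coboundaries P n"
  unfolding coboundaries_def by (cases n) (auto intro!: image_eqI[where x = 0])

lemma coboundaries_diff:
  assumes "(b :: 'v list \<Rightarrow>\<^sub>0 'k) \<in> coboundaries P n" and "b' \<in> coboundaries P n"
  shows "b - b' \<in> coboundaries P n"
  using assms unfolding coboundaries_def
  by (cases n) (auto simp: differential_diff[symmetric] intro: cochains_diff)

lemma dH_coboundary: "f \<in> cochains P n \<Longrightarrow> differential P (H f) \<in> coboundaries P n"
  by (cases n) (auto simp: coboundaries_def H_0 intro: H_cochains)

lemma cocycles_diff: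
  "u \<in> cocycles P n \<Longrightarrow> v \<in> cocycles P n \<Longrightarrow> u - v \<in> (cocycles P n :: ('v list \<Rightarrow>\<^sub>0 'k) set)"
  by (simp add: cocycles_def cochains_diff differential_diff)

lemma cohomology_trivial:
  assumes "n \<noteq> r"
  shows "is_singleton (cohomology TYPE('k) P n)"
  unfolding cohomology_def
proof (rule is_singleton_subquotient)
  show "0 \<in> cocycles P n"
    by (simp add: cocycles_def)
  fix u v :: "'v list \<Rightarrow>\<^sub>0 'k"
  assume "u \<in> cocycles P n" "v \<in> cocycles P n"
  then have w: "u - v \<in> cocycles P n"
    by (rule cocycles_diff)
  show "u - v \<in> coboundaries P n"
  proof (cases "n < r")
    case True
    with w have "u - v = differential P (H (u - v))"
      using homotopy[of n "u - v"] by (simp add: cocycles_def)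
    with w show ?thesis
      using dH_coboundary[of "u - v" n] by (simp add: cocycles_def)
  next
    case False
    with assms w have "u - v = 0"
      by (intro cochains_above[of n]) (simp_all add: cocycles_def)
    then show ?thesis
      by (simp add: coboundaries_zero)
  qed
qed

text \<open>If b = d g is supported on J, then H b = 0 by \<open>H_J\<close>. Since g has degree
  below r, this gives g = d (H g), so b = d d (H g) = 0. It is the independence of the classes of
  J.\<close>

lemma coboundary_on_J:
  assumes "(b :: 'v list \<Rightarrow>\<^sub>0 'k) \<in> coboundaries P r" and "Poly_Mapping.keys b \<subseteq> J"
  shows "b = 0"
proof (cases r)
  case (Suc q)
  with assms(1) obtain g :: "'v list \<Rightarrow>\<^sub>0 'k" where g: "g \<in> cochains P q" "b = differential P g"
    by (auto simp: coboundaries_def)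
  have "g = differential P (H g)"
    using homotopy[OF _ g(1)] Suc H_J[OF assms(2)] g(2) by simp
  then have "b = differential P (differential P (H g))"
    using g(2) by simp
  also have "\<dots> = 0"
  proof (cases q)
    case 0
    with g(1) show ?thesis
      by (simp add: H_0)
  next
    case (Suc q')
    with g(1) show ?thesis
      by (auto intro: differential_differential H_cochains)
  qed
  finally show ?thesis .
qed (use assms in \<open>simp add: coboundaries_def\<close>)

text \<open>The indicator cochains of J are the basis. They span because d f = 0 in top degree,
  which leaves f - d (H f) as a representative supported on J; they are independent by
  \<open>coboundary_on_J\<close>.\<close>

lemma cohomology_top: "cohomology_free_of_rank TYPE('k) P r (card J)"
proof -
  obtain b where b: "bij_betw b {..<card J} J"
    using ex_bij_betw_nat_finite[OF finite_J] unfolding atLeast0LessThan by blast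
  then have b_in: "b i \<in> J" if "i < card J" for i
    using that by (auto simp: bij_betw_def)
  define e where "e i = Poly_Mapping.single (b i) (1 :: 'k)" for i
  define F where "F c = (\<Sum>i<card J. scale (c i) (e i))" for c
  have lookup_F: "Poly_Mapping.lookup (F c) xs = (\<Sum>i<card J. c i when b i = xs)" for c xs
    unfolding F_def e_def
    by (simp add: lookup_sum lookup_single when_def if_distrib cong: if_cong)
  have F_b: "Poly_Mapping.lookup (F c) (b j) = c j" if "j < card J" for c j
  proof -
    have "Poly_Mapping.lookup (F c) (b j) = (\<Sum>i<card J. if i = j then c i else 0)"
      unfolding lookup_F when_def
      by (rule sum.cong) (use that b in \<open>auto simp: bij_betw_def inj_on_def\<close>)
    with that show ?thesis
      by simp
  qed
  have F_J: "Poly_Mapping.keys (F c) \<subseteq> J" for c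
  proof
    fix xs
    assume "xs \<in> Poly_Mapping.keys (F c)"
    then have "\<exists>i<card J. b i = xs"
      unfolding in_keys_iff lookup_F by (auto simp: when_def intro: ccontr)
    then show "xs \<in> J"
      using b_in by blast
  qed
  have J_cochains: "f \<in> cochains P r" if "Poly_Mapping.keys f \<subseteq> J" for f :: "'v list \<Rightarrow>\<^sub>0 'k"
    using that J_subset by (auto simp: cochains_def)
  have d_0: "differential P f = 0" if "f \<in> cochains P r" for f :: "'v list \<Rightarrow>\<^sub>0 'k"
    using cochains_above[of "Suc r"] differential_cochains[OF that] by simp
  have cocycles: "cocycles P r = (cochains P r :: ('v list \<Rightarrow>\<^sub>0 'k) set)"
    using d_0 by (auto simp: cocycles_def)
  let ?Z = "cocycles P r :: ('v list \<Rightarrow>\<^sub>0 'k) set" and ?B = "coboundaries P r :: ('v list \<Rightarrow>\<^sub>0 'k) set"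
  have F_Z: "F c \<in> ?Z" for c
    unfolding cocycles by (rule J_cochains[OF F_J])
  have mod_iff: "mod_rel ?Z ?B `` {u} = mod_rel ?Z ?B `` {v} \<longleftrightarrow> u - v \<in> ?B"
    if "u \<in> ?Z" "v \<in> ?Z" for u v
    using that by (intro mod_rel_eq_iff coboundaries_zero coboundaries_diff)
  have "bij_betw (\<lambda>c. mod_rel ?Z ?B `` {F c}) ({..<card J} \<rightarrow>\<^sub>E UNIV) (subquotient ?Z ?B)"
  proof (rule bij_betwI')
    fix c c' :: "nat \<Rightarrow> 'k"
    assume c: "c \<in> {..<card J} \<rightarrow>\<^sub>E UNIV" "c' \<in> {..<card J} \<rightarrow>\<^sub>E UNIV"
    show "mod_rel ?Z ?B `` {F c} = mod_rel ?Z ?B `` {F c'} \<longleftrightarrow> c = c'"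
    proof
      assume "mod_rel ?Z ?B `` {F c} = mod_rel ?Z ?B `` {F c'}"
      then have "F c - F c' \<in> ?B"
        by (rule mod_iff[OF F_Z F_Z, THEN iffD1])
      moreover have "Poly_Mapping.keys (F c - F c') \<subseteq> J"
        using F_J[of c] F_J[of c'] keys_diff[of "F c" "F c'"] by blast
      ultimately have "F c = F c'"
        using coboundary_on_J[of "F c - F c'"] by simp
      then have "c i = c' i" if "i < card J" for i
        using F_b[OF that] by metis
      with c show "c = c'"
        by (intro PiE_ext[of c _ _ c']) auto
    qed simp
  next
    fix c :: "nat \<Rightarrow> 'k"
    show "mod_rel ?Z ?B `` {F c} \<in> subquotient ?Z ?B"
      using F_Z by (auto simp: subquotient_def quotient_def)
  next
    fix A
    assume "A \<in> subquotient ?Z ?B"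
    then obtain f where f: "f \<in> ?Z" "A = mod_rel ?Z ?B `` {f}"
      by (auto simp: subquotient_def quotient_def)
    then have fc: "f \<in> cochains P r"
      by (simp add: cocycles)
    let ?g = "f - differential P (H f)"
    \<comment> \<open>Coefficient vectors are extensional functions, hence
      \<open>restrict\<close>.\<close>
    define c where "c = restrict (\<lambda>i. Poly_Mapping.lookup ?g (b i)) {..<card J}"
    have g: "Poly_Mapping.keys ?g \<subseteq> J"
      using H_homotopy[OF fc] by (simp add: d_0[OF fc])
    have "F c = ?g"
    proof (rule poly_mapping_eqI)
      fix xs
      show "Poly_Mapping.lookup (F c) xs = Poly_Mapping.lookup ?g xs"
      proof (cases "xs \<in> J")
        case True
        then obtain i where "i < card J" "xs = b i"
          using b by (auto simp: bij_betw_def)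
        then show ?thesis
          by (simp only: F_b) (simp add: c_def)
      next
        case False
        then have "xs \<notin> Poly_Mapping.keys (F c)" "xs \<notin> Poly_Mapping.keys ?g"
          using g F_J by blast+
        then show ?thesis
          by (simp only: in_keys_iff not_not)
      qed
    qed
    then have "f - F c \<in> ?B"
      using dH_coboundary[OF fc] by simp
    then have "A = mod_rel ?Z ?B `` {F c}"
      unfolding f(2) by (rule mod_iff[OF f(1) F_Z, THEN iffD2])
    then show "\<exists>c\<in>{..<card J} \<rightarrow>\<^sub>E UNIV. A = mod_rel ?Z ?B `` {F c}"
      by (intro bexI[of _ c]) (auto simp: c_def)
  qed
  moreover have "e i \<in> ?Z" if "i < card J" for i
    unfolding cocycles e_def by (rule J_cochains) (use b_in[OF that] in auto)
  ultimately show ?thesis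
    unfolding cohomology_free_of_rank_def subquotient_free_of_rank_def F_def by blast
qed

text \<open>The transposed contraction: below degree r the boundary of \<omega> = \<chi> \<circ> H
  sends f to \<chi> (H (d f)) = \<chi> (f - d (H f)) = \<chi> f, because a cycle \<chi> vanishes on
  the image of d. Above degree r all cochains are zero.\<close>

lemma homology_trivial:
  assumes "n \<noteq> r"
  shows "is_singleton (homology TYPE('k) P n)"
  unfolding homology_def
proof (rule is_singleton_subquotient)
  \<comment> \<open>One description for all degrees; for n = 0 the condition is vacuous.\<close>
  have cycles: "dual_cycles P n = {\<phi> \<in> dual_chains P n. \<forall>m. n = Suc m \<longrightarrow>
      (\<forall>f\<in>cochains P m. \<phi> (differential P f) = (0 :: 'k))}"
    unfolding dual_cycles_def by (cases n) (auto simp: boundary_def fun_eq_iff)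
  show "0 \<in> (dual_cycles P n :: (('v list \<Rightarrow>\<^sub>0 'k) \<Rightarrow> 'k) set)"
    unfolding cycles by (simp add: dual_chains_def)
  fix \<phi> \<psi> :: "('v list \<Rightarrow>\<^sub>0 'k) \<Rightarrow> 'k"
  assume "\<phi> \<in> dual_cycles P n" "\<psi> \<in> dual_cycles P n"
  then have \<chi>: "\<phi> - \<psi> \<in> dual_cycles P n"
    unfolding cycles by (simp add: dual_chains_def right_diff_distrib)
  define \<chi> where "\<chi> = \<phi> - \<psi>"
  have cyc: "\<chi> \<in> dual_cycles P n"
    using \<chi> by (simp add: \<chi>_def)
  then have ch: "\<chi> \<in> dual_chains P n"
    by (simp add: cycles)
  then have \<chi>_add: "\<chi> (f + g) = \<chi> f + \<chi> g" if "f \<in> cochains P n" "g \<in> cochains P n" for f g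
    using that by (simp add: dual_chains_def)
  have \<chi>_scale: "\<chi> (scale c f) = c * \<chi> f" if "f \<in> cochains P n" for c f
    using ch that by (simp add: dual_chains_def)
  have \<chi>_0: "\<chi> 0 = 0"
    using \<chi>_scale[of 0 0] by simp
  have \<chi>_outside: "\<chi> f = 0" if "f \<notin> cochains P n" for f
    using ch that by (simp add: dual_chains_def)
  define \<omega> where "\<omega> g = (if g \<in> cochains P (Suc n) then \<chi> (H g) else 0)" for g
  have "\<omega> \<in> dual_chains P (Suc n)"
    unfolding dual_chains_def \<omega>_def
    by (auto simp: cochains_add cochains_scale \<chi>_add \<chi>_scale H_cochains H_add[of _ "Suc n"]
        H_scale[of _ "Suc n"])
  moreover have "\<chi> = boundary P n \<omega>"
  proof
    fix f
    show "\<chi> f = boundary P n \<omega> f"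
    proof (cases "f \<in> cochains P n")
      case True
      then have d: "differential P f \<in> cochains P (Suc n)"
        by (rule differential_cochains)
      have dH: "\<chi> (differential P (H f)) = 0"
      proof (cases n)
        case 0
        with True show ?thesis
          by (simp add: H_0 \<chi>_0)
      next
        case (Suc m)
        with True cyc show ?thesis
          unfolding cycles by (auto intro: H_cochains)
      qed
      show ?thesis
      proof (cases "n < r")
        case n: True
        have "\<chi> f = \<chi> (differential P (H f) + H (differential P f))"
          using homotopy[OF n True] by simp
        also have "\<dots> = \<chi> (H (differential P f))"
          using dH_cochains[OF True] H_cochains[OF d] dH by (simp add: \<chi>_add)
        finally show ?thesis
          using True d by (simp add: boundary_def \<omega>_def)
      next
        case False
        then have "f = 0"
          using assms True by (intro cochains_above[of n]) simp_all
        then show ?thesis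
          by (simp add: boundary_def \<omega>_def \<chi>_0)
      qed
    qed (simp add: boundary_def \<chi>_outside)
  qed
  ultimately show "\<phi> - \<psi> \<in> dual_boundaries P n"
    unfolding dual_boundaries_def \<chi>_def by blast
qed

end

text \<open>As 0 \<noteq> 1 in a \<open>comm_ring_1\<close>, the coefficient vectors constantly 0
  and constantly 1 differ for 0 < m and represent different classes.\<close>

lemma subquotient_free_of_rank_nontrivial:
  assumes "subquotient_free_of_rank (s :: 'k::comm_ring_1 \<Rightarrow> _) Z B m" and "0 < m"
  shows "\<not> is_singleton (subquotient Z B)"
proof
  assume "is_singleton (subquotient Z B)"
  moreover obtain g where "bij_betw g ({..<m} \<rightarrow>\<^sub>E (UNIV :: 'k set)) (subquotient Z B)"
    using assms(1) unfolding subquotient_free_of_rank_def by blast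
  ultimately have "card ({..<m} \<rightarrow>\<^sub>E (UNIV :: 'k set)) = 1"
    using bij_betw_same_card is_singleton_altdef by metis
  then obtain c0 where c0: "{..<m} \<rightarrow>\<^sub>E (UNIV :: 'k set) = {c0}"
    by (auto simp: card_1_singleton_iff)
  have "restrict (\<lambda>_. u) {..<m} = c0" for u
    using c0 by (metis PiE_restrict restrict_PiE_iff UNIV_I singletonD)
  then have "restrict (\<lambda>_. 0 :: 'k) {..<m} 0 = restrict (\<lambda>_. 1) {..<m} 0"
    by metis
  with assms(2) show False
    by simp
qed

section \<open>Semimodular lattices are Cohen--Macaulay\<close>

text \<open>\<open>differential\<close> inserts and \<open>cobound\<close> deletes. Solving the
  insertion equation for the shorter list and the inserted element passes from one to the
  other.\<close>

lemma insert_nth_eq_iff: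
  assumes "i \<le> length zs"
  shows "take i zs @ [u] @ drop i zs = xs \<longleftrightarrow>
    i < length xs \<and> zs = take i xs @ drop (Suc i) xs \<and> u = xs ! i"
proof
  assume "take i zs @ [u] @ drop i zs = xs"
  then show "i < length xs \<and> zs = take i xs @ drop (Suc i) xs \<and> u = xs ! i"
    using assms by (auto simp: nth_append)
next
  assume *: "i < length xs \<and> zs = take i xs @ drop (Suc i) xs \<and> u = xs ! i"
  then show "take i zs @ [u] @ drop i zs = xs"
    by (simp add: id_take_nth_drop[symmetric])
qed

context ranked_semimodular_lattice
begin

lemma interval_simps [simp]:
  "carrier (interval L x y) = {z \<in> carrier L. x \<sqsubseteq> z \<and> z \<sqsubseteq> y}"
  "z \<sqsubseteq>\<^bsub>interval L x y\<^esub> w \<longleftrightarrow> z \<sqsubseteq> w"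
  "z \<sqsubset>\<^bsub>interval L x y\<^esub> w \<longleftrightarrow> z \<sqsubset> w"
  by (simp_all add: interval_def at_least_at_most_def lless_def)

lemma spanning_chains_interval:
  assumes x: "x \<in> carrier L" and y: "y \<in> carrier L" and le: "x \<sqsubseteq> y"
  shows "spanning_chains (interval L x y) n = {xs \<in> chains x y. length xs = Suc n}"
proof -
  have min: "minimal (interval L x y) z \<longleftrightarrow> z = x" for z
    unfolding minimal_def using x y le by (auto intro: le_antisym)
  have max: "maximal (interval L x y) z \<longleftrightarrow> z = y" for z
    unfolding maximal_def using x y le by (auto intro: le_antisym)
  show ?thesis
    unfolding spanning_chains_def min max interval_simps
    using chain_le_last chain_first_le by (auto simp: chains_def)
qed

lemma chain_insert:
  assumes zs: "zs \<in> chains x y" and i: "0 < i" "i < length zs"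
    and u: "u \<in> carrier L" "zs ! (i - 1) \<sqsubset> u" "u \<sqsubset> zs ! i"
  shows "take i zs @ [u] @ drop i zs \<in> chains x y"
proof -
  have c: "set zs \<subseteq> carrier L" and s: "sorted_wrt (\<sqsubset>) zs"
    using zs by (auto simp: chains_def)
  have below: "\<forall>v\<in>set (take i zs). v \<sqsubset> u"
  proof
    fix v
    assume "v \<in> set (take i zs)"
    then obtain k where k: "k < i" "v = zs ! k"
      using i by (auto simp: in_set_conv_nth)
    show "v \<sqsubset> u"
    proof (cases "k = i - 1")
      case False
      then have "v \<sqsubset> zs ! (i - 1)"
        using k i s by (auto intro: sorted_wrt_nth_less)
      then show ?thesis
        using u c k i by (intro lless_trans[of v "zs ! (i - 1)" u]) auto
    qed (use k u in simp)
  qed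
  have above: "\<forall>v\<in>set (drop i zs). u \<sqsubset> v"
  proof
    fix v
    assume "v \<in> set (drop i zs)"
    then obtain k' where "k' < length zs - i" "v = zs ! (i + k')"
      by (auto simp: in_set_conv_nth)
    then have k: "i \<le> i + k'" "i + k' < length zs" "v = zs ! (i + k')"
      by auto
    show "u \<sqsubset> v"
    proof (cases "k' = 0")
      case False
      then have "zs ! i \<sqsubset> v"
        using k i s by (auto intro: sorted_wrt_nth_less)
      then show ?thesis
        using u c k i by (intro lless_trans[of u "zs ! i" v]) auto
    qed (use k u in simp)
  qed
  have s': "sorted_wrt (\<sqsubset>) (take i zs @ drop i zs)"
    using s by simp
  have "sorted_wrt (\<sqsubset>) (take i zs @ [u] @ drop i zs)"
    using s' below above unfolding sorted_wrt_append by simp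
  moreover have "hd (take i zs @ [u] @ drop i zs) = hd zs" "last (take i zs @ [u] @ drop i zs) = last zs"
    using i by (auto simp: hd_append)
  moreover have "set (take i zs @ [u] @ drop i zs) \<subseteq> carrier L"
    using c u(1) set_take_subset[of i zs] set_drop_subset[of i zs] by auto
  ultimately show ?thesis
    using zs by (simp add: chains_def)
qed

text \<open>The coefficient at \<open>xs\<close> collects the triples (zs, i, u) whose insertion
  gives \<open>xs\<close>. For a fixed inner position i the only candidate is \<open>xs\<close> with
  entry i deleted together with u = \<open>xs ! i\<close>, which for a chain does lie strictly
  between its neighbours. A candidate outside the keys of f has coefficient 0 anyway.\<close>

lemma lookup_differential:
  fixes f :: "'v list \<Rightarrow>\<^sub>0 'k::comm_ring_1"
  assumes x: "x \<in> carrier L" and y: "y \<in> carrier L" and le: "x \<sqsubseteq> y"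
    and f: "f \<in> cochains (interval L x y) n"
  shows "Poly_Mapping.lookup (differential (interval L x y) f) = cobound x y (Poly_Mapping.lookup f)"
proof
  fix xs
  define B where "B zs i = {u \<in> carrier (interval L x y). zs ! (i - 1) \<sqsubset> u \<and> u \<sqsubset> zs ! i}"
    for zs :: "'v list" and i
  have keys: "zs \<in> chains x y" "length zs = Suc n" if "zs \<in> Poly_Mapping.keys f" for zs
    using that f by (auto simp: cochains_def spanning_chains_interval[OF x y le])
  have "Poly_Mapping.lookup (differential (interval L x y) f) xs =
      (\<Sum>zs\<in>Poly_Mapping.keys f. Poly_Mapping.lookup f zs *
        (\<Sum>i\<in>{1..<length zs}. \<Sum>u\<in>B zs i. (- 1) ^ i when take i zs @ [u] @ drop i zs = xs))"
    unfolding differential_def d_symbol_def B_def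
    by (simp add: lookup_sum lookup_single)
  also have "\<dots> = (\<Sum>zs\<in>Poly_Mapping.keys f. \<Sum>i\<in>{1..<Suc n}. \<Sum>u\<in>B zs i.
      if take i zs @ [u] @ drop i zs = xs then Poly_Mapping.lookup f zs * (- 1) ^ i else 0)"
  proof (rule sum.cong[OF HOL.refl])
    fix zs
    assume zs: "zs \<in> Poly_Mapping.keys f"
    show "Poly_Mapping.lookup f zs * (\<Sum>i\<in>{1..<length zs}. \<Sum>u\<in>B zs i.
        (- 1) ^ i when take i zs @ [u] @ drop i zs = xs) =
      (\<Sum>i\<in>{1..<Suc n}. \<Sum>u\<in>B zs i.
        if take i zs @ [u] @ drop i zs = xs then Poly_Mapping.lookup f zs * (- 1) ^ i else 0)"
      unfolding keys(2)[OF zs] sum_distrib_left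
      by (intro sum.cong HOL.refl) (simp only: when_def if_distrib[of "(*) _"] mult_zero_right)
  qed
  also have "\<dots> = cobound x y (Poly_Mapping.lookup f) xs"
  proof (cases "xs \<in> chains x y \<and> length xs = n + 2")
    \<comment> \<open>Inserting into a chain of n + 1 elements yields a chain of n + 2 elements, so
      both sides vanish at any other list.\<close>
    case False
    have "take i zs @ [u] @ drop i zs \<noteq> xs"
      if "zs \<in> Poly_Mapping.keys f" "i \<in> {1..<Suc n}" "u \<in> B zs i" for zs i u
    proof
      assume "take i zs @ [u] @ drop i zs = xs"
      moreover have "take i zs @ [u] @ drop i zs \<in> chains x y"
        using that keys[OF that(1)] by (intro chain_insert) (auto simp: B_def)
      moreover have "length (take i zs @ [u] @ drop i zs) = n + 2"
        using keys[OF that(1)] that by simp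
      ultimately show False
        using False by simp
    qed
    then have "(\<Sum>zs\<in>Poly_Mapping.keys f. \<Sum>i\<in>{1..<Suc n}. \<Sum>u\<in>B zs i.
        if take i zs @ [u] @ drop i zs = xs then Poly_Mapping.lookup f zs * (- 1) ^ i else 0) = 0"
      by (intro sum.neutral ballI if_not_P) blast
    moreover have "Poly_Mapping.lookup f \<in> coch x y (Suc n)"
      using f by (auto simp: coch_def cochains_iff spanning_chains_interval[OF x y le])
    from cobound_coch[OF this] have "cobound x y (Poly_Mapping.lookup f) xs = 0"
      using False by (intro coch_eq_0) auto
    ultimately show ?thesis
      by simp
  next
    case True
    then have ne: "x \<noteq> y"
      using x by (auto simp: chains_self)
    with True obtain ys where xs: "xs = x # ys @ [y]"
      using chains_ends by blast
    then have len: "length ys = n"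
      using True by simp
    have c: "set xs \<subseteq> carrier L" and s: "sorted_wrt (\<sqsubset>) xs"
      using True by (auto simp: chains_def)
    let ?del = "\<lambda>i. take i xs @ drop (Suc i) xs"
    have inner: "(\<Sum>u\<in>B zs i. if take i zs @ [u] @ drop i zs = xs
        then Poly_Mapping.lookup f zs * (- 1) ^ i else 0) =
        (if ?del i = zs then Poly_Mapping.lookup f zs * (- 1) ^ i else 0)"
      if zs: "zs \<in> Poly_Mapping.keys f" and i: "i \<in> {1..<Suc n}" for zs i
    proof -
      have *: "take i zs @ [u] @ drop i zs = xs \<longleftrightarrow> ?del i = zs \<and> u = xs ! i" for u
        using insert_nth_eq_iff[of i zs u xs] keys(2)[OF zs] i True by auto
      have "xs ! i \<in> B zs i" if d: "?del i = zs"
      proof -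
        have "zs ! (i - 1) = xs ! (i - 1)" "zs ! i = xs ! Suc i"
          using i True by (auto simp: d[symmetric] nth_append)
        moreover have "xs ! (i - 1) \<sqsubset> xs ! i" "xs ! i \<sqsubset> xs ! Suc i" "xs ! i \<in> set xs"
          using i True s by (auto intro: sorted_wrt_nth_less)
        ultimately show ?thesis
          using True c chain_le_last[of xs x y] chain_first_le[of xs x y] by (auto simp: B_def)
      qed
      moreover have "finite (B zs i)"
        using finite_carrier by (simp add: B_def)
      ultimately show ?thesis
        unfolding * by (cases "?del i = zs") (simp_all add: sum.delta)
    qed
    have "(\<Sum>zs\<in>Poly_Mapping.keys f. \<Sum>i\<in>{1..<Suc n}. \<Sum>u\<in>B zs i.
        if take i zs @ [u] @ drop i zs = xs then Poly_Mapping.lookup f zs * (- 1) ^ i else 0) =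
        (\<Sum>zs\<in>Poly_Mapping.keys f. \<Sum>i\<in>{1..<Suc n}.
          if ?del i = zs then Poly_Mapping.lookup f zs * (- 1) ^ i else 0)"
      by (intro sum.cong HOL.refl inner)
    also have "\<dots> = (\<Sum>i\<in>{1..<Suc n}. \<Sum>zs\<in>Poly_Mapping.keys f.
          if ?del i = zs then Poly_Mapping.lookup f zs * (- 1) ^ i else 0)"
      by (rule sum.swap)
    also have "\<dots> = (\<Sum>i\<in>{1..<Suc n}. (- 1) ^ i * Poly_Mapping.lookup f (?del i))"
      by (rule sum.cong) (simp_all add: in_keys_iff mult.commute)
    \<comment> \<open>With i = j + 1, entry i of \<open>xs\<close> is entry j of \<open>ys\<close>;
      the shift yields the overall minus sign of \<open>cobound\<close>.\<close>
    also have "\<dots> = (\<Sum>j<n. - ((- 1) ^ j * Poly_Mapping.lookup f (x # (take j ys @ drop (Suc j) ys) @ [y])))"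
      unfolding One_nat_def sum.atLeast_Suc_lessThan_Suc_shift lessThan_atLeast0
      by (rule sum.cong) (simp_all add: xs len)
    also have "\<dots> = cobound x y (Poly_Mapping.lookup f) xs"
      using True by (simp add: xs cobound_Cons_snoc alt_sum_conv_sum len sum_negf)
    finally show ?thesis .
  qed
  finally show "Poly_Mapping.lookup (differential (interval L x y) f) xs =
    cobound x y (Poly_Mapping.lookup f) xs" .
qed

lemma finite_support_coch:
  assumes "\<phi> \<in> coch x y n"
  shows "finite {xs. \<phi> xs \<noteq> 0}"
proof (rule finite_subset)
  show "{xs. \<phi> xs \<noteq> 0} \<subseteq> {xs. set xs \<subseteq> carrier L \<and> length xs = n}"
    using coch_nonzeroD[OF assms] by (auto simp: chains_def)
qed (simp add: finite_carrier finite_lists_length_eq)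

text \<open>List length turns into degree here: \<open>coch x y (Suc n)\<close> corresponds to
  \<open>cochains\<close> in degree n. So \<open>h\<close>, which shortens lists by one, must vanish
  in degree 0, as no chain is empty.\<close>

lemma spherical_top_contraction:
  assumes x: "x \<in> carrier L" and y: "y \<in> carrier L" and le: "x \<sqsubseteq> y"
    and "spherical TYPE('k::comm_ring_1) x y m"
  obtains J and H :: "('v list \<Rightarrow>\<^sub>0 'k::comm_ring_1) \<Rightarrow> ('v list \<Rightarrow>\<^sub>0 'k)"
  where "top_contraction (interval L x y) (rk y - rk x) J H" and "card J = m"
proof -
  obtain J and h :: "('v list \<Rightarrow> 'k) \<Rightarrow> 'v list \<Rightarrow> 'k"
    where J: "J \<subseteq> maximal_chains x y" "card J = m" and h: "contraction x y J h"
    using assms(4) by (auto simp: spherical_def)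
  let ?P = "interval L x y"
  \<comment> \<open>\<open>Abs_poly_mapping\<close> can be undone only for finite support. On
    cochains this holds because the lists have fixed length over a finite carrier.\<close>
  define H where "H f = Abs_poly_mapping (h (Poly_Mapping.lookup f))" for f :: "'v list \<Rightarrow>\<^sub>0 'k"
  note span = spanning_chains_interval[OF x y le]
  have coch: "Poly_Mapping.lookup f \<in> coch x y (Suc n) \<longleftrightarrow> f \<in> cochains ?P n"
    for f :: "'v list \<Rightarrow>\<^sub>0 'k" and n
    by (auto simp: coch_def cochains_iff span)
  have Abs_zero: "Abs_poly_mapping 0 = (0 :: 'v list \<Rightarrow>\<^sub>0 'k)"
    by (simp only: zero_poly_mapping_def zero_fun_def)
  have h_coch: "h (Poly_Mapping.lookup f) \<in> coch x y n" if "f \<in> cochains ?P n" for f n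
    using contraction_coch[OF h coch[THEN iffD2, OF that]] by simp
  then have H: "Poly_Mapping.lookup (H f) = h (Poly_Mapping.lookup f)" if "f \<in> cochains ?P n" for f n
    unfolding H_def using finite_support_coch[OF h_coch[OF that]] by (simp add: Abs_poly_mapping_inverse)
  note d = lookup_differential[OF x y le]
  have d_cochains: "differential ?P f \<in> cochains ?P (Suc n)" if "f \<in> cochains ?P n"
    for f :: "'v list \<Rightarrow>\<^sub>0 'k" and n
    by (rule coch[THEN iffD1], unfold d[OF that], rule cobound_coch, rule coch[THEN iffD2, OF that])
  have H_0: "H f = 0" if "f \<in> cochains ?P 0" for f
    by (simp only: H_def coch_0[OF h_coch[OF that]] Abs_zero)
  have H_Suc: "H f \<in> cochains ?P n" if "f \<in> cochains ?P (Suc n)" for f n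
    by (rule coch[THEN iffD1], unfold H[OF that], rule h_coch[OF that])
  have "top_contraction ?P (rk y - rk x) J H"
  proof
    show "finite J"
      using J finite_maximal_chains by (blast intro: finite_subset)
    show "J \<subseteq> spanning_chains ?P (rk y - rk x)"
      using J by (auto simp: span maximal_chains_def)
    show "spanning_chains ?P n = {}" if "rk y - rk x < n" for n
      using that length_chain_le by (fastforce simp: span)
    show "differential ?P f \<in> cochains ?P (Suc n)" if "f \<in> cochains ?P n"
      for n and f :: "'v list \<Rightarrow>\<^sub>0 'k"
      by (rule d_cochains[OF that])
    show "differential ?P (differential ?P f) = 0" if "f \<in> cochains ?P n"
      for n and f :: "'v list \<Rightarrow>\<^sub>0 'k"
      by (rule poly_mapping_eqI) (simp add: d[OF that] d[OF d_cochains[OF that]] cobound_cobound)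
    show "H f = 0" if "f \<in> cochains ?P 0" for f
      by (rule H_0[OF that])
    show "H f \<in> cochains ?P n" if "f \<in> cochains ?P (Suc n)" for n f
      by (rule H_Suc[OF that])
    show "H (f + g) = H f + H g" if "f \<in> cochains ?P n" "g \<in> cochains ?P n" for n f g
    proof (rule poly_mapping_eqI)
      fix xs
      have "Poly_Mapping.lookup (f + g) = Poly_Mapping.lookup f + Poly_Mapping.lookup g"
        by (simp add: fun_eq_iff lookup_add)
      then show "Poly_Mapping.lookup (H (f + g)) xs = Poly_Mapping.lookup (H f + H g) xs"
        using that by (simp add: H[OF cochains_add] H lookup_add contraction_add[OF h])
    qed
    show "H (scale c f) = scale c (H f)" if "f \<in> cochains ?P n" for n c f
    proof (rule poly_mapping_eqI)
      fix xs
      have "Poly_Mapping.lookup (scale c f) = (\<lambda>xs. c * Poly_Mapping.lookup f xs)"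
        by (simp add: fun_eq_iff)
      then show "Poly_Mapping.lookup (H (scale c f)) xs = Poly_Mapping.lookup (scale c (H f)) xs"
        using that by (simp add: H[OF cochains_scale] H contraction_scale[OF h])
    qed
    show "Poly_Mapping.keys (f - (differential ?P (H f) + H (differential ?P f))) \<subseteq> J"
      if f: "f \<in> cochains ?P n" for n f
    proof (rule subsetI, rule ccontr)
      fix xs
      assume k: "xs \<in> Poly_Mapping.keys (f - (differential ?P (H f) + H (differential ?P f)))"
        and "xs \<notin> J"
      have dH: "Poly_Mapping.lookup (differential ?P (H f)) = cobound x y (h (Poly_Mapping.lookup f))"
      proof (cases n)
        case 0
        with f have "H f = 0" "h (Poly_Mapping.lookup f) = 0"
          using H_0[of f] coch_0[OF h_coch[of f]] by simp_all
        then show ?thesis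
          by (simp only: differential_zero cobound_zero) (simp add: fun_eq_iff)
      next
        case (Suc q)
        with f H_Suc d[of "H f" q] show ?thesis
          by (simp add: H[OF f])
      qed
      have "differential ?P (H f) \<in> cochains ?P n"
        using f by (cases n) (auto simp: H_0 intro: d_cochains H_Suc)
      then have "f - (differential ?P (H f) + H (differential ?P f)) \<in> cochains ?P n"
        using f by (intro cochains_diff cochains_add H_Suc d_cochains)
      with k have "xs \<in> chains x y - J"
        using \<open>xs \<notin> J\<close> by (auto simp: cochains_def span)
      from contraction_homotopy[OF h coch[THEN iffD2, OF f] this] k show False
        by (simp add: in_keys_iff lookup_minus lookup_add dH H[OF d_cochains[OF f]] d[OF f])
    qed
    show "H f = 0" if "Poly_Mapping.keys f \<subseteq> J" for f
    proof -
      have "h (Poly_Mapping.lookup f) = 0"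
        using that by (intro contraction_critical[OF h]) (auto simp: in_keys_iff)
      then show ?thesis
        by (simp only: H_def Abs_zero)
    qed
  qed
  with J(2) show ?thesis
    using that by blast
qed

lemma interval_rank_eq:
  assumes x: "x \<in> carrier L" and y: "y \<in> carrier L" and le: "x \<sqsubseteq> y"
  shows "interval_rank L x y = rk y - rk x"
  unfolding interval_rank_def spanning_chains_interval[OF x y le]
proof (rule Max_eqI)
  let ?A = "{n. {xs \<in> chains x y. length xs = Suc n} \<noteq> {}}"
  show upper: "n \<le> rk y - rk x" if "n \<in> ?A" for n
  proof -
    from that obtain xs where "xs \<in> chains x y" "length xs = Suc n"
      by blast
    with length_chain_le[of xs x y] show ?thesis
      by simp
  qed
  then show "finite ?A"
    by (meson finite_nat_set_iff_bounded_le)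
  show "rk y - rk x \<in> ?A"
    using ex_saturated_chain[OF x y le] by auto
qed

theorem Cohen_Macaulay: "Cohen_Macaulay TYPE('k::comm_ring_1) L"
  unfolding Cohen_Macaulay_def
proof (intro conjI ballI impI allI)
  fix x y n
  assume xy: "x \<in> carrier L" "y \<in> carrier L" "x \<sqsubseteq> y" and n: "n \<noteq> interval_rank L x y"
  obtain m where "spherical TYPE('k) x y m"
    using ex_spherical[OF xy] by blast
  then obtain J and H :: "('v list \<Rightarrow>\<^sub>0 'k) \<Rightarrow> ('v list \<Rightarrow>\<^sub>0 'k)"
    where H: "top_contraction (interval L x y) (rk y - rk x) J H"
    using spherical_top_contraction[OF xy] by blast
  from top_contraction.homology_trivial[OF H] n
  show "is_singleton (homology TYPE('k) (interval L x y) n)"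
    by (simp add: interval_rank_eq[OF xy])
qed (rule graded)

end

section \<open>The non-singleton boolean poset\<close>

locale nonsingleton_boolean =
  fixes S :: "'a set"
  assumes finite_S: "finite S" and nonempty_S: "S \<noteq> {}"
begin

text \<open>The empty set stands for the partition into singletons. One-element sets would give the
  same partition; leaving them out makes \<open>part\<close> injective.\<close>

definition nonsingletons :: "'a set set" where
  "nonsingletons = {B. B \<subseteq> S \<and> card B \<noteq> 1}"

definition part :: "'a set \<Rightarrow> 'a set set" where
  "part B = ({B} - {{}}) \<union> (\<lambda>s. {s}) ` (S - B)"

lemma part_partition: "B \<subseteq> S \<Longrightarrow> partition_on S (part B)"
  unfolding part_def by (rule partition_onI) (auto simp: disjnt_def)

lemma nonsingletons_finite: "B \<in> nonsingletons \<Longrightarrow> finite B"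
  using finite_S by (auto simp: nonsingletons_def intro: finite_subset)

lemma nonsingletons_card: "B \<in> nonsingletons \<Longrightarrow> B = {} \<or> 2 \<le> card B"
proof -
  assume B: "B \<in> nonsingletons"
  then have "card B = 0 \<longleftrightarrow> B = {}" "card B \<noteq> 1"
    using nonsingletons_finite[OF B] by (simp_all add: nonsingletons_def)
  then show ?thesis
    by linarith
qed

lemma empty_nonsingleton [simp]: "{} \<in> nonsingletons"
  by (simp add: nonsingletons_def)

lemma large_block_part: "A \<in> part B \<Longrightarrow> 2 \<le> card A \<Longrightarrow> A = B"
  by (auto simp: part_def)

lemma part_closed: "B \<subseteq> S \<Longrightarrow> part B \<in> carrier (NS S)"
  using part_partition[of B] large_block_part[of _ B] unfolding NS_def by simp blast

lemma closed_part:
  assumes "\<alpha> \<in> carrier (NS S)"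
  obtains B where "B \<in> nonsingletons" and "\<alpha> = part B"
proof -
  have p: "partition_on S \<alpha>" and u: "\<And>A B. A \<in> \<alpha> \<Longrightarrow> B \<in> \<alpha> \<Longrightarrow> 2 \<le> card A \<Longrightarrow> 2 \<le> card B \<Longrightarrow> A = B"
    using assms by (auto simp: NS_def)
  have S: "\<Union>\<alpha> = S" and dj: "\<And>A B. A \<in> \<alpha> \<Longrightarrow> B \<in> \<alpha> \<Longrightarrow> A \<noteq> B \<Longrightarrow> A \<inter> B = {}" and ne: "{} \<notin> \<alpha>"
    using p by (auto simp: partition_on_def disjoint_def)
  have small: "\<exists>s. A = {s}" if "A \<in> \<alpha>" "\<not> 2 \<le> card A" for A
  proof -
    have "A \<noteq> {}" "finite A"
      using that(1) ne S finite_S by (auto intro: finite_subset)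
    then have "card A \<noteq> 0"
      by simp
    with that(2) have "card A = 1"
      by linarith
    then show ?thesis
      by (auto simp: card_1_singleton_iff)
  qed
  show ?thesis
  proof (cases "\<exists>B\<in>\<alpha>. 2 \<le> card B")
    case True
    then obtain B where B: "B \<in> \<alpha>" "2 \<le> card B"
      by blast
    have "\<alpha> = part B"
    proof (intro equalityI subsetI)
      fix A
      assume A: "A \<in> \<alpha>"
      show "A \<in> part B"
      proof (cases "A = B")
        case True
        then show ?thesis
          using ne B by (auto simp: part_def)
      next
        case False
        then obtain s where "A = {s}"
          using small[OF A] u[OF A B(1) _ B(2)] by blast
        then show ?thesis
          using dj[OF A B(1) False] A S by (auto simp: part_def)
      qed
    next
      fix A
      assume "A \<in> part B"
      then consider "A = B" | s where "s \<in> S - B" "A = {s}"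
        by (auto simp: part_def)
      then show "A \<in> \<alpha>"
      proof cases
        case 2
        then obtain C where C: "C \<in> \<alpha>" "s \<in> C"
          using S by blast
        with 2 u[OF C(1) B(1) _ B(2)] small[OF C(1)] show ?thesis
          by auto
      qed (use B in simp)
    qed
    moreover have "B \<in> nonsingletons"
      using B S by (auto simp: nonsingletons_def)
    ultimately show ?thesis
      by (intro that)
  next
    case False
    have "\<alpha> = part {}"
    proof (intro equalityI subsetI)
      fix A
      assume A: "A \<in> \<alpha>"
      then obtain s where "A = {s}"
        using small False by blast
      then show "A \<in> part {}"
        using A S by (auto simp: part_def)
    next
      fix A
      assume "A \<in> part {}"
      then obtain s where s: "s \<in> S" "A = {s}"
        by (auto simp: part_def)
      then obtain C where C: "C \<in> \<alpha>" "s \<in> C"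
        using S by blast
      with s False small[OF C(1)] show "A \<in> \<alpha>"
        by auto
    qed
    with empty_nonsingleton show ?thesis
      by (rule that)
  qed
qed

text \<open>A block of \<open>part B\<close> containing some c in C contains the block of
  \<open>part C\<close> around c, which is C. It therefore has at least two elements and must be
  B.\<close>

lemma merging_part_iff:
  assumes B: "B \<in> nonsingletons" and C: "C \<in> nonsingletons"
  shows "merging (part B) (part C) \<longleftrightarrow> C \<subseteq> B"
proof
  assume m: "merging (part B) (part C)"
  show "C \<subseteq> B"
  proof (cases "C = {}")
    case False
    then obtain c where c: "c \<in> C"
      by blast
    then have "c \<in> S"
      using C by (auto simp: nonsingletons_def)
    then obtain A where A: "A \<in> part B" "c \<in> A"
      using B part_partition[of B] by (auto simp: nonsingletons_def partition_on_def)
    then obtain \<B> where "\<B> \<subseteq> part C" "A = \<Union>\<B>"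
      using m unfolding merging_def by blast
    with A(2) obtain X where X: "X \<in> part C" "c \<in> X" "X \<subseteq> A"
      by blast
    then have "C \<subseteq> A"
      using c by (auto simp: part_def)
    moreover have "finite A"
      using A(1) nonsingletons_finite[OF B] by (auto simp: part_def)
    ultimately have "2 \<le> card A"
      using nonsingletons_card[OF C] False card_mono[of A C] by auto
    then have "A = B"
      using A(1) large_block_part by blast
    with \<open>C \<subseteq> A\<close> show ?thesis
      by simp
  qed simp
next
  assume CB: "C \<subseteq> B"
  have BS: "B \<subseteq> S"
    using B by (simp add: nonsingletons_def)
  show "merging (part B) (part C)"
    unfolding merging_def
  proof
    fix A
    assume "A \<in> part B"
    then consider "A = B" | s where "s \<in> S - B" "A = {s}"
      by (auto simp: part_def)
    then show "\<exists>\<B>\<subseteq>part C. A = \<Union>\<B>"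
    proof cases
      case 1
      with CB BS show ?thesis
        by (intro exI[of _ "({C} - {{}}) \<union> (\<lambda>s. {s}) ` (B - C)"]) (auto simp: part_def)
    next
      case 2
      with CB show ?thesis
        by (intro exI[of _ "{{s}}"]) (auto simp: part_def)
    qed
  qed
qed

lemma le_part_iff [simp]:
  "B \<in> nonsingletons \<Longrightarrow> C \<in> nonsingletons \<Longrightarrow> part B \<sqsubseteq>\<^bsub>NS S\<^esub> part C \<longleftrightarrow> C \<subseteq> B"
  by (simp add: NS_def merging_part_iff)

lemma nonsingletons_closed [simp]: "B \<in> nonsingletons \<Longrightarrow> part B \<in> carrier (NS S)"
  by (rule part_closed) (simp add: nonsingletons_def)

lemma part_eq_iff:
  "B \<in> nonsingletons \<Longrightarrow> C \<in> nonsingletons \<Longrightarrow> part B = part C \<longleftrightarrow> B = C"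
  using merging_part_iff[of B B] merging_part_iff[of B C] merging_part_iff[of C B] by auto

lemma carrier_NS: "carrier (NS S) = part ` nonsingletons"
  using closed_part by (auto intro: nonsingletons_closed)

section \<open>Lattice structure, covers and rank of \<open>NS S\<close>\<close>

sublocale partial_order "NS S"
proof
  fix x y z
  show "x .=\<^bsub>NS S\<^esub> x" by (simp add: NS_def)
  show "x .=\<^bsub>NS S\<^esub> y \<Longrightarrow> y .=\<^bsub>NS S\<^esub> x" by (simp add: NS_def)
  show "x .=\<^bsub>NS S\<^esub> y \<Longrightarrow> y .=\<^bsub>NS S\<^esub> z \<Longrightarrow> x .=\<^bsub>NS S\<^esub> z" by (simp add: NS_def)
  show "x \<in> carrier (NS S) \<Longrightarrow> x \<sqsubseteq>\<^bsub>NS S\<^esub> x"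
    by (auto simp: carrier_NS)
  show "x \<sqsubseteq>\<^bsub>NS S\<^esub> y \<Longrightarrow> y \<sqsubseteq>\<^bsub>NS S\<^esub> x \<Longrightarrow> x \<in> carrier (NS S) \<Longrightarrow> y \<in> carrier (NS S) \<Longrightarrow> x .=\<^bsub>NS S\<^esub> y"
    by (auto simp: carrier_NS) (simp add: NS_def)
  show "x \<sqsubseteq>\<^bsub>NS S\<^esub> y \<Longrightarrow> y \<sqsubseteq>\<^bsub>NS S\<^esub> z \<Longrightarrow> x \<in> carrier (NS S) \<Longrightarrow> y \<in> carrier (NS S) \<Longrightarrow>
      z \<in> carrier (NS S) \<Longrightarrow> x \<sqsubseteq>\<^bsub>NS S\<^esub> z"
    by (auto simp: carrier_NS)
  show "x .=\<^bsub>NS S\<^esub> y \<Longrightarrow> z .=\<^bsub>NS S\<^esub> w \<Longrightarrow> x \<sqsubseteq>\<^bsub>NS S\<^esub> z \<longleftrightarrow> y \<sqsubseteq>\<^bsub>NS S\<^esub> w" for w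
    by (simp add: NS_def)
  show "(.=\<^bsub>NS S\<^esub>) = (=)"
    by (simp add: NS_def)
qed

lemma lless_part_iff:
  "B \<in> nonsingletons \<Longrightarrow> C \<in> nonsingletons \<Longrightarrow> part B \<sqsubset>\<^bsub>NS S\<^esub> part C \<longleftrightarrow> C \<subset> B"
  by (auto simp: lless_eq part_eq_iff)

text \<open>For members of \<open>nonsingletons\<close> this is the largest member inside the
  intersection: a one-element intersection contains no member but the empty set.\<close>

definition join_set :: "'a set \<Rightarrow> 'a set \<Rightarrow> 'a set" where
  "join_set B C = (if card (B \<inter> C) = 1 then {} else B \<inter> C)"

lemma join_set: "B \<in> nonsingletons \<Longrightarrow> join_set B C \<in> nonsingletons"
  by (auto simp: join_set_def nonsingletons_def)

lemma subset_join_set_iff: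
  assumes "D \<in> nonsingletons"
  shows "D \<subseteq> join_set B C \<longleftrightarrow> D \<subseteq> B \<and> D \<subseteq> C"
proof -
  have "D = {}" if sub: "D \<subseteq> B \<inter> C" and one: "card (B \<inter> C) = 1"
  proof -
    obtain s where "B \<inter> C = {s}"
      using one by (auto simp: card_1_singleton_iff)
    with sub assms show ?thesis
      by (auto simp: nonsingletons_def subset_singleton_iff)
  qed
  then show ?thesis
    by (auto simp: join_set_def)
qed

lemma union_nonsingleton:
  assumes "B \<in> nonsingletons" and "C \<in> nonsingletons"
  shows "B \<union> C \<in> nonsingletons"
proof -
  have "card B \<le> card (B \<union> C)" "card C \<le> card (B \<union> C)"
    using nonsingletons_finite[OF assms(1)] nonsingletons_finite[OF assms(2)]
    by (auto intro: card_mono)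
  then show ?thesis
    using assms nonsingletons_card[of B] nonsingletons_card[of C] by (auto simp: nonsingletons_def)
qed

sublocale lattice "NS S"
proof
  fix x y
  assume "x \<in> carrier (NS S)" "y \<in> carrier (NS S)"
  then obtain B C where B: "B \<in> nonsingletons" "x = part B" and C: "C \<in> nonsingletons" "y = part C"
    by (auto simp: carrier_NS)
  have "least (NS S) (part (join_set B C)) (Upper (NS S) {x, y})"
    using B C subset_join_set_iff[OF join_set[OF B(1)], of C B C]
    by (intro least_UpperI)
      (auto simp: carrier_NS Upper_def join_set subset_join_set_iff)
  then show "\<exists>s. least (NS S) s (Upper (NS S) {x, y})" ..
  have "greatest (NS S) (part (B \<union> C)) (Lower (NS S) {x, y})"
    using B C by (intro greatest_LowerI) (auto simp: carrier_NS Lower_def union_nonsingleton)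
  then show "\<exists>s. greatest (NS S) s (Lower (NS S) {x, y})" ..
qed

lemma join_part:
  assumes "B \<in> nonsingletons" and "C \<in> nonsingletons"
  shows "part B \<squnion>\<^bsub>NS S\<^esub> part C = part (join_set B C)"
proof (rule le_antisym)
  show "part B \<squnion>\<^bsub>NS S\<^esub> part C \<sqsubseteq>\<^bsub>NS S\<^esub> part (join_set B C)"
    using assms subset_join_set_iff[OF join_set[OF assms(1)], of C B C]
    by (intro join_le) (auto simp: join_set)
  obtain D where D: "D \<in> nonsingletons" "part B \<squnion>\<^bsub>NS S\<^esub> part C = part D"
    using assms join_closed[of "part B" "part C"] by (auto simp: carrier_NS)
  then show "part (join_set B C) \<sqsubseteq>\<^bsub>NS S\<^esub> part B \<squnion>\<^bsub>NS S\<^esub> part C"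
    using assms join_left[of "part B" "part C"] join_right[of "part B" "part C"]
    by (simp add: join_set subset_join_set_iff)
qed (simp_all add: assms join_set)

lemma meet_part:
  assumes "B \<in> nonsingletons" and "C \<in> nonsingletons"
  shows "part B \<sqinter>\<^bsub>NS S\<^esub> part C = part (B \<union> C)"
proof (rule le_antisym)
  show "part (B \<union> C) \<sqsubseteq>\<^bsub>NS S\<^esub> part B \<sqinter>\<^bsub>NS S\<^esub> part C"
    using assms by (intro meet_le) (auto simp: union_nonsingleton)
  obtain D where D: "D \<in> nonsingletons" "part B \<sqinter>\<^bsub>NS S\<^esub> part C = part D"
    using assms meet_closed[of "part B" "part C"] by (auto simp: carrier_NS)
  then show "part B \<sqinter>\<^bsub>NS S\<^esub> part C \<sqsubseteq>\<^bsub>NS S\<^esub> part (B \<union> C)"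
    using assms meet_left[of "part B" "part C"] meet_right[of "part B" "part C"]
    by (simp add: union_nonsingleton)
qed (simp_all add: assms union_nonsingleton)

text \<open>Removing one element is the generic cover. A pair is adjacent to the empty set because
  the singletons in between are missing.\<close>

lemma covered_part_iff:
  assumes B: "B \<in> nonsingletons" and C: "C \<in> nonsingletons"
  shows "covered (NS S) (part B) (part C) \<longleftrightarrow>
    C \<subset> B \<and> (card B = Suc (card C) \<or> C = {} \<and> card B = 2)"
proof -
  have "covered (NS S) (part B) (part C) \<longleftrightarrow> C \<subset> B \<and> \<not> (\<exists>D\<in>nonsingletons. C \<subset> D \<and> D \<subset> B)"
    using assms by (auto simp: covered_def carrier_NS lless_part_iff)
  also have "\<dots> \<longleftrightarrow> C \<subset> B \<and> (card B = Suc (card C) \<or> C = {} \<and> card B = 2)"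
  proof (intro conj_cong refl iffI notI)
    assume CB: "C \<subset> B" and no: "\<not> (\<exists>D\<in>nonsingletons. C \<subset> D \<and> D \<subset> B)"
    show "card B = Suc (card C) \<or> C = {} \<and> card B = 2"
    proof (cases "C = {}")
      case True
      with CB have "2 \<le> card B"
        using nonsingletons_card[OF B] by auto
      then obtain D where D: "D \<subseteq> B" "card D = 2"
        using obtain_subset_with_card_n by metis
      with B have "D \<in> nonsingletons"
        by (auto simp: nonsingletons_def)
      with no D True have "D = B"
        by fastforce
      with True D show ?thesis
        by simp
    next
      case False
      from CB obtain b where b: "b \<in> B" "b \<notin> C"
        by blast
      have fin: "finite C"
        by (rule nonsingletons_finite[OF C])
      have "insert b C \<in> nonsingletons"
        using b B C False fin by (auto simp: nonsingletons_def)
      with no CB b have "insert b C = B"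
        by blast
      with b fin show ?thesis
        by auto
    qed
  next
    assume CB: "C \<subset> B" and card: "card B = Suc (card C) \<or> C = {} \<and> card B = 2"
      and "\<exists>D\<in>nonsingletons. C \<subset> D \<and> D \<subset> B"
    then obtain D where D: "D \<in> nonsingletons" "C \<subset> D" "D \<subset> B"
      by blast
    then have "card C < card D" "card D < card B" "card D \<noteq> 1"
      using nonsingletons_finite[OF B] nonsingletons_finite[OF D(1)]
      by (auto intro: psubset_card_mono simp: nonsingletons_def)
    with card show False
      by auto
  qed
  finally show ?thesis .
qed

definition rank :: "'a set set \<Rightarrow> nat" where
  "rank \<alpha> = card \<alpha> - 1"

text \<open>\<open>max 1\<close> occurs because the empty set yields as many blocks as a singleton
  would.\<close>

lemma rank_part:
  assumes "B \<in> nonsingletons"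
  shows "rank (part B) = card S - max 1 (card B)"
proof -
  have fin: "finite B" "B \<subseteq> S"
    using assms nonsingletons_finite[OF assms] by (auto simp: nonsingletons_def)
  have "card (part B) = card ({B} - {{}}) + card (S - B)"
    unfolding part_def using finite_S by (subst card_Un_disjoint) (auto simp: card_image)
  moreover have "card (S - B) = card S - card B" "card B \<le> card S"
    using fin finite_S by (auto simp: card_Diff_subset card_mono)
  ultimately show ?thesis
    using fin nonsingletons_card[OF assms] by (cases "B = {}") (auto simp: rank_def)
qed

sublocale ranked_semimodular_lattice "NS S" rank
proof
  have "finite nonsingletons"
    using finite_S by (auto simp: nonsingletons_def)
  then show "finite (carrier (NS S))"
    by (simp add: carrier_NS)
  show "rank y = Suc (rank x)" if c: "covered (NS S) x y" for x y
  proof -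
    obtain B C where B: "B \<in> nonsingletons" "x = part B" and C: "C \<in> nonsingletons" "y = part C"
      using c by (auto simp: covered_def carrier_NS)
    have "card B \<le> card S"
      using B(1) finite_S by (auto simp: nonsingletons_def intro: card_mono)
    moreover have "card B \<noteq> 1" "card C \<noteq> 1"
      using B C by (auto simp: nonsingletons_def)
    moreover have "card B = Suc (card C) \<or> card C = 0 \<and> card B = 2"
      using c B C by (auto simp: covered_part_iff)
    ultimately show ?thesis
      using B C by (auto simp: rank_part max_def)
  qed
  show "semimodular (NS S)"
    unfolding semimodular_def
  proof (intro ballI impI)
    fix x y
    assume "x \<in> carrier (NS S)" "y \<in> carrier (NS S)" and c: "covered (NS S) (x \<sqinter>\<^bsub>NS S\<^esub> y) x"
    then obtain B C where B: "B \<in> nonsingletons" "x = part B" and C: "C \<in> nonsingletons" "y = part C"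
      by (auto simp: carrier_NS)
    have fin: "finite B" "finite C"
      using nonsingletons_finite B(1) C(1) by blast+
    have u: "B \<subset> B \<union> C" "card (B \<union> C) = Suc (card B) \<or> B = {} \<and> card (B \<union> C) = 2"
      using c B C by (auto simp: meet_part covered_part_iff union_nonsingleton)
    \<comment> \<open>If B \<union> C has one element more than B, then C has one more than B
      \<inter> C; should B \<inter> C be a singleton, C is a pair and \<open>join_set\<close> is
      empty, the exceptional kind of cover. If B is empty, C itself is the pair.\<close>
    have card: "card B + card C = card (B \<union> C) + card (B \<inter> C)"
      by (rule card_Un_Int[OF fin])
    have "card C \<noteq> 1"
      using C by (simp add: nonsingletons_def)
    have "join_set B C \<subset> C"
      using u(1) by (auto simp: join_set_def)
    moreover have "card C = Suc (card (join_set B C)) \<or> join_set B C = {} \<and> card C = 2"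
      using u(2) card \<open>card C \<noteq> 1\<close> by (auto simp: join_set_def)
    ultimately show "covered (NS S) y (x \<squnion>\<^bsub>NS S\<^esub> y)"
      using B C by (simp add: join_part covered_part_iff join_set)
  qed
qed

end

section \<open>Atoms of \<open>NS S\<close>, the count of surviving chains, and the
  cohomology\<close>

context nonsingleton_boolean
begin

text \<open>For one-element S the poset is a point, represented by the empty set.\<close>

definition least_set :: "'a set" where
  "least_set = (if card S = 1 then {} else S)"

lemma least_set_closed [simp]: "least_set \<in> nonsingletons"
  by (simp add: least_set_def nonsingletons_def)

lemma subset_least_set: "B \<in> nonsingletons \<Longrightarrow> B \<subseteq> least_set"
  by (auto simp: least_set_def nonsingletons_def card_1_singleton_iff subset_singleton_iff)

lemma bottom_NS: "\<bottom>\<^bsub>NS S\<^esub> = part least_set"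
proof -
  have least: "least (NS S) (part least_set) (carrier (NS S))"
    by (auto simp: least_def carrier_NS subset_least_set)
  then have "least (NS S) \<bottom>\<^bsub>NS S\<^esub> (carrier (NS S))"
    unfolding bottom_def by (rule someI)
  with least show ?thesis
    by (rule least_unique[symmetric])
qed

lemma large_least_set:
  assumes "B \<in> nonsingletons" and "s \<in> B"
  shows "2 \<le> card S" "least_set = S"
proof -
  have "2 \<le> card B" "card B \<le> card S"
    using assms nonsingletons_card[OF assms(1)] finite_S
    by (auto simp: nonsingletons_def intro: card_mono)
  then show "2 \<le> card S" "least_set = S"
    by (auto simp: least_set_def)
qed

text \<open>The set of the atom that separates \<open>s\<close> from the rest of \<open>S\<close>. For \<open>card S = 2\<close> this
  atom is the top element, since \<open>S - {s}\<close> is a singleton.\<close>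

definition atom_set :: "'a \<Rightarrow> 'a set" where
  "atom_set s = (if card S = 2 then {} else S - {s})"

lemma atom_set:
  assumes "2 \<le> card S" and "s \<in> S"
  shows "atom_set s \<in> nonsingletons" "covered (NS S) (part least_set) (part (atom_set s))"
proof -
  have card: "card (S - {s}) = card S - 1"
    using assms(2) by simp
  show *: "atom_set s \<in> nonsingletons"
    using assms by (auto simp: atom_set_def nonsingletons_def card)
  show "covered (NS S) (part least_set) (part (atom_set s))"
    unfolding covered_part_iff[OF least_set_closed *]
    using assms by (auto simp: least_set_def atom_set_def card)
qed

lemma subset_atom_set:
  assumes "B \<in> nonsingletons" and "s \<in> S" and "s \<notin> B"
  shows "B \<subseteq> atom_set s"
proof (cases "card S = 2 \<and> B \<noteq> {}")
  case True
  then have "2 \<le> card B" "B \<subseteq> S"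
    using assms(1) nonsingletons_card[OF assms(1)] by (auto simp: nonsingletons_def)
  then have "B = S"
    using True finite_S card_subset_eq[of S B] card_mono[of S B] by simp
  with assms show ?thesis
    by simp
next
  case False
  with assms show ?thesis
    by (auto simp: atom_set_def nonsingletons_def)
qed

text \<open>Every element is the join of the atoms below it: if an upper bound \<open>part C\<close>
  of the atoms below \<open>part B\<close> had t in C outside B, the atom separating t would be one
  of them. Then C would lie inside \<open>atom_set t\<close>, which omits t.\<close>

lemma geometric: "geometric_lattice (NS S)"
proof -
  have "atomistic (NS S)"
    unfolding atomistic_def
  proof
    fix x
    assume "x \<in> carrier (NS S)"
    then obtain B where B: "B \<in> nonsingletons" "x = part B"
      by (auto simp: carrier_NS)
    let ?A = "{a \<in> carrier (NS S). atom (NS S) a \<and> a \<sqsubseteq>\<^bsub>NS S\<^esub> x}"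
    have "is_lub (NS S) x ?A"
    proof (rule least_UpperI)
      fix w
      assume w: "w \<in> Upper (NS S) ?A"
      then obtain C where C: "C \<in> nonsingletons" "w = part C"
        using Upper_closed[of "NS S" ?A] by (auto simp: carrier_NS)
      have "C \<subseteq> B"
      proof
        fix t
        assume t: "t \<in> C"
        show "t \<in> B"
        proof (rule ccontr)
          assume "t \<notin> B"
          have S: "2 \<le> card S" "t \<in> S"
            using large_least_set[OF C(1) t] C(1) t by (auto simp: nonsingletons_def)
          note a = atom_set[OF S]
          have "part (atom_set t) \<in> ?A"
            using a B subset_atom_set[OF B(1) S(2) \<open>t \<notin> B\<close>] by (simp add: atom_def bottom_NS)
          then have "part (atom_set t) \<sqsubseteq>\<^bsub>NS S\<^esub> w"
            using w by (auto simp: Upper_def)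
          then have "C \<subseteq> atom_set t"
            using C a by simp
          with t show False
            by (auto simp: atom_set_def split: if_splits)
        qed
      qed
      with B C show "x \<sqsubseteq>\<^bsub>NS S\<^esub> w"
        by simp
    qed (use B in auto)
    then show "\<exists>A. (\<forall>a\<in>A. atom (NS S) a) \<and> is_lub (NS S) x A"
      by (intro exI[of _ ?A]) simp
  qed
  moreover have "carrier (NS S) \<noteq> {}"
    using nonsingletons_closed[OF empty_nonsingleton] by blast
  ultimately show ?thesis
    unfolding geometric_lattice_def
    using lattice_axioms finite_carrier semimodular by blast
qed

text \<open>An element of \<open>NS S\<close> fails to be above the atom separating s exactly when
  its set contains s, so the coatoms in question enlarge D by s. For empty D one element is not
  enough, which is the origin of \<open>max 2\<close>: the sets are then the pairs containing
  s.\<close>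

lemma coatoms_off_part:
  assumes D: "D \<in> nonsingletons" and s: "s \<in> S" "s \<notin> D" and S: "2 \<le> card S"
  defines "a \<equiv> part (atom_set s)"
  shows "interval_atom (NS S) rank (part least_set) (part D) a"
    and "interval_atom.coatoms_off (NS S) (part least_set) (part D) a =
      part ` {B \<in> nonsingletons. insert s D \<subseteq> B \<and> card B = max 2 (Suc (card D))}"
proof -
  note a = atom_set[OF S s(1)]
  show "interval_atom (NS S) rank (part least_set) (part D) a"
    unfolding a_def by unfold_locales (use a D subset_atom_set[OF D s] in auto)
  then interpret I: interval_atom "NS S" rank "part least_set" "part D" a .
  have D2: "D = {} \<or> 2 \<le> card D" "finite D" "D \<subseteq> S"
    using nonsingletons_card[OF D] nonsingletons_finite[OF D] D by (auto simp: nonsingletons_def)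
  show "I.coatoms_off = part ` {B \<in> nonsingletons. insert s D \<subseteq> B \<and> card B = max 2 (Suc (card D))}"
  proof (intro equalityI subsetI)
    fix h
    assume h: "h \<in> I.coatoms_off"
    then have h': "h \<in> carrier (NS S)" "h \<sqsubset>\<^bsub>NS S\<^esub> part D" "I.clo h = part D"
      by (auto simp: I.coatoms_off_def)
    then obtain B where B: "B \<in> nonsingletons" "h = part B"
      by (auto simp: carrier_NS)
    have "covered (NS S) (part B) (part D)"
      using I.coatoms_off_covered[OF h] B by simp
    then have DB: "D \<subset> B" "card B = Suc (card D) \<or> D = {} \<and> card B = 2"
      by (auto simp: covered_part_iff[OF B(1) D])
    moreover have "card B \<noteq> 1"
      using B by (simp add: nonsingletons_def)
    ultimately have "card B = max 2 (Suc (card D))"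
      using D2 by auto
    moreover have "s \<in> B"
    proof (rule ccontr)
      assume "s \<notin> B"
      then have "a \<sqsubseteq>\<^bsub>NS S\<^esub> h"
        using B a subset_atom_set[OF B(1) s(1)] by (simp add: a_def)
      then have "I.clo h = h"
        using h' by (intro I.clo_eq)
      with h' show False
        by (simp add: lless_eq)
    qed
    ultimately show "h \<in> part ` {B \<in> nonsingletons. insert s D \<subseteq> B \<and> card B = max 2 (Suc (card D))}"
      using B DB by auto
  next
    fix h
    assume "h \<in> part ` {B \<in> nonsingletons. insert s D \<subseteq> B \<and> card B = max 2 (Suc (card D))}"
    then obtain B where B: "B \<in> nonsingletons" "h = part B" "insert s D \<subseteq> B"
      "card B = max 2 (Suc (card D))"
      by blast
    have "B \<inter> atom_set s \<subseteq> B - {s}"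
      by (auto simp: atom_set_def)
    \<comment> \<open>Without s, the set B is D itself or, for empty D, a single element, which
      \<open>join_set\<close> discards.\<close>
    have eq: "join_set B (atom_set s) = D"
    proof
      show "D \<subseteq> join_set B (atom_set s)"
        using B subset_atom_set[OF D s] by (simp add: subset_join_set_iff[OF D])
      have fin: "finite B"
        by (rule nonsingletons_finite[OF B(1)])
      have card: "card (B - {s}) = max 1 (card D)"
        using B by (auto simp: max_def)
      show "join_set B (atom_set s) \<subseteq> D"
      proof (cases "D = {}")
        case True
        with card obtain t where "B - {s} = {t}"
          by (auto simp: card_1_singleton_iff)
        with \<open>B \<inter> atom_set s \<subseteq> B - {s}\<close> have "B \<inter> atom_set s = {} \<or> B \<inter> atom_set s = {t}"
          by auto
        with True show ?thesis
          by (auto simp: join_set_def)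
      next
        case False
        with D2 card have "card (B - {s}) = card D" "D \<subseteq> B - {s}"
          using B s by auto
        then have "D = B - {s}"
          using fin by (intro card_subset_eq) auto
        with \<open>B \<inter> atom_set s \<subseteq> B - {s}\<close> show ?thesis
          by (auto simp: join_set_def)
      qed
    qed
    have "D \<subset> B"
      using B s by auto
    moreover have "I.clo h = part D"
      unfolding I.clo_def by (simp add: a_def B(2) join_part[OF B(1) a(1)] eq)
    ultimately show "h \<in> I.coatoms_off"
      using B(1,2) D by (simp add: I.coatoms_off_def lless_part_iff subset_least_set)
  qed
qed

text \<open>Between a nonempty D and S no set is missing, so this interval is boolean. The sum of
  \<open>spherical_step\<close> then has the single term \<open>insert s D\<close>, and the
  recursion runs up to D = S.\<close>

lemma spherical_boolean:
  assumes "D \<in> nonsingletons" and "D \<noteq> {}"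
  shows "spherical TYPE('k::comm_ring_1) (part least_set) (part D) 1"
  using assms
proof (induction "card (S - D)" arbitrary: D rule: less_induct)
  case less
  obtain d where "d \<in> D"
    using less.prems by blast
  note S = large_least_set[OF less.prems(1) this]
  have D: "D \<subseteq> S" "finite D" "2 \<le> card D"
    using less.prems nonsingletons_card[OF less.prems(1)] nonsingletons_finite[OF less.prems(1)]
    by (simp_all add: nonsingletons_def)
  show ?case
  proof (cases "D = S")
    case True
    then show ?thesis
      using spherical_self[OF nonsingletons_closed[OF least_set_closed]] S(2) by simp
  next
    case False
    then obtain s where s: "s \<in> S" "s \<notin> D"
      using D by blast
    interpret I: interval_atom "NS S" rank "part least_set" "part D" "part (atom_set s)"
      by (rule coatoms_off_part(1)[OF less.prems(1) s S(1)])
    have card: "card (insert s D) = Suc (card D)"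
      using s D by simp
    have B: "insert s D \<in> nonsingletons"
      using s D card by (auto simp: nonsingletons_def)
    have "{B \<in> nonsingletons. insert s D \<subseteq> B \<and> card B = max 2 (Suc (card D))} = {insert s D}"
    proof (intro equalityI subsetI)
      fix B
      assume "B \<in> {B \<in> nonsingletons. insert s D \<subseteq> B \<and> card B = max 2 (Suc (card D))}"
      then have *: "B \<in> nonsingletons" "insert s D \<subseteq> B" "card B = card (insert s D)"
        using D(3) card by simp_all
      from card_subset_eq[OF nonsingletons_finite[OF *(1)] *(2)] *(3) show "B \<in> {insert s D}"
        by simp
    next
      fix B
      assume "B \<in> {insert s D}"
      then show "B \<in> {B \<in> nonsingletons. insert s D \<subseteq> B \<and> card B = max 2 (Suc (card D))}"
        using B D(3) card by auto
    qed
    then have co: "I.coatoms_off = {part (insert s D)}"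
      using coatoms_off_part(2)[OF less.prems(1) s S(1)] by simp
    have "card (S - insert s D) < card (S - D)"
      using s finite_S by (intro psubset_card_mono) auto
    then have "spherical TYPE('k) (part least_set) (part (insert s D)) 1"
      using B by (intro less.hyps) auto
    then have "spherical TYPE('k) (part least_set) (part D) (\<Sum>H\<in>I.coatoms_off. 1)"
      by (intro I.spherical_step) (simp add: co)
    then show ?thesis
      by (simp add: co)
  qed
qed

text \<open>The contributing coatoms are the pairs {s,t}, one for each t other than s, and each
  counts 1 by \<open>spherical_boolean\<close>.\<close>

lemma spherical_NS:
  assumes "2 \<le> card S"
  shows "spherical TYPE('k::comm_ring_1) (part least_set) (part {}) (card S - 1)"
proof -
  obtain s where s: "s \<in> S" "s \<notin> {}"
    using nonempty_S by blast
  interpret I: interval_atom "NS S" rank "part least_set" "part {}" "part (atom_set s)"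
    by (rule coatoms_off_part(1)[OF empty_nonsingleton s assms])
  have "{B \<in> nonsingletons. insert s {} \<subseteq> B \<and> card B = max 2 (Suc (card {}))} = (\<lambda>t. {s, t}) ` (S - {s})"
  proof (intro equalityI subsetI)
    fix B
    assume "B \<in> {B \<in> nonsingletons. insert s {} \<subseteq> B \<and> card B = max 2 (Suc (card {}))}"
    then have B: "B \<subseteq> S" "s \<in> B" "card B = 2"
      by (auto simp: nonsingletons_def)
    then obtain t where "B = {s, t}" "t \<noteq> s"
      by (auto simp: card_2_iff)
    with B show "B \<in> (\<lambda>t. {s, t}) ` (S - {s})"
      by auto
  next
    fix B
    assume "B \<in> (\<lambda>t. {s, t}) ` (S - {s})"
    then obtain t where "t \<in> S" "t \<noteq> s" "B = {s, t}"
      by blast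
    with s show "B \<in> {B \<in> nonsingletons. insert s {} \<subseteq> B \<and> card B = max 2 (Suc (card {}))}"
      by (auto simp: nonsingletons_def)
  qed
  then have co: "I.coatoms_off = part ` (\<lambda>t. {s, t}) ` (S - {s})"
    using coatoms_off_part(2)[OF empty_nonsingleton s assms] by simp
  have pair: "{s, t} \<in> nonsingletons" if "t \<in> S - {s}" for t
    using that s by (auto simp: nonsingletons_def)
  have "inj_on (\<lambda>t. part {s, t}) (S - {s})"
    using pair by (intro inj_onI) (auto simp: part_eq_iff doubleton_eq_iff)
  then have "card I.coatoms_off = card S - 1"
    using s by (simp add: co image_image card_image)
  moreover have "spherical TYPE('k) (part least_set) (part {}) (\<Sum>H\<in>I.coatoms_off. 1)"
  proof (rule I.spherical_step)
    fix H
    assume "H \<in> I.coatoms_off"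
    then obtain t where t: "t \<in> S - {s}" "H = part {s, t}"
      by (auto simp: co)
    show "spherical TYPE('k) (part least_set) H 1"
      unfolding t(2) by (rule spherical_boolean[OF pair[OF t(1)]]) simp
  qed
  ultimately show ?thesis
    by simp
qed

lemma interval_NS: "interval (NS S) (part least_set) (part {}) = NS S"
proof -
  have "{z \<in> carrier (NS S). part least_set \<sqsubseteq>\<^bsub>NS S\<^esub> z \<and> z \<sqsubseteq>\<^bsub>NS S\<^esub> part {}} = carrier (NS S)"
    by (auto simp: carrier_NS subset_least_set)
  then show ?thesis
    by (simp add: interval_def at_least_at_most_def)
qed

text \<open>For one-element S the poset is a point, whose cohomology in degree 0 has rank 1 and not
  \<open>card S - 1\<close>; this is the exceptional value of \<open>m\<close>. In all cases
  \<open>m\<close> is positive, so the top group is nonzero.\<close>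

lemma cohomology_NS:
  defines "m \<equiv> (if card S = 1 then 1 else card S - 1)"
  shows "n \<noteq> card S - 1 \<Longrightarrow> is_singleton (cohomology TYPE('k::comm_ring_1) (NS S) n)"
    and "cohomology_free_of_rank TYPE('k) (NS S) (card S - 1) m"
    and "\<not> is_singleton (cohomology TYPE('k) (NS S) (card S - 1))"
proof -
  have card_S: "card S \<noteq> 0"
    using finite_S nonempty_S by simp
  have sph: "spherical TYPE('k) (part least_set) (part {}) m"
  proof (cases "card S = 1")
    case True
    then show ?thesis
      using spherical_self[of "part {}"] by (simp add: m_def least_set_def)
  next
    case False
    with card_S have "2 \<le> card S"
      by linarith
    from spherical_NS[OF this] False show ?thesis
      by (simp add: m_def)
  qed
  have rank: "rank (part {}) - rank (part least_set) = card S - 1"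
    by (simp add: rank_part) (simp add: least_set_def max_def)
  obtain J and H :: "('a set set list \<Rightarrow>\<^sub>0 'k) \<Rightarrow> ('a set set list \<Rightarrow>\<^sub>0 'k)"
    where "top_contraction (NS S) (card S - 1) J H" and J: "card J = m"
    using spherical_top_contraction[OF _ _ _ sph] unfolding interval_NS rank by auto
  then interpret top_contraction "NS S" "card S - 1" J H
    by simp
  show "n \<noteq> card S - 1 \<Longrightarrow> is_singleton (cohomology TYPE('k) (NS S) n)"
    by (rule cohomology_trivial)
  show free: "cohomology_free_of_rank TYPE('k) (NS S) (card S - 1) m"
    using cohomology_top J by simp
  have "0 < m"
    using card_S by (auto simp: m_def)
  with free show "\<not> is_singleton (cohomology TYPE('k) (NS S) (card S - 1))"
    unfolding cohomology_free_of_rank_def cohomology_def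
    by (rule subquotient_free_of_rank_nontrivial)
qed

end

theorem proposition5p5:
  fixes S :: "'a set"
  assumes "finite S" and "S \<noteq> {}"
  shows "geometric_lattice (NS S)
    \<and> Cohen_Macaulay TYPE('k::comm_ring_1) (NS S)
    \<and> (\<forall>n. \<not> is_singleton (cohomology TYPE('k) (NS S) n) \<longleftrightarrow> n = card S - 1)
    \<and> (2 \<le> card S \<longrightarrow>
         cohomology_free_of_rank TYPE('k) (NS S) (card S - 1) (card S - 1))
    \<and> (card S = 1 \<longrightarrow> cohomology_free_of_rank TYPE('k) (NS S) (card S - 1) 1)"
proof -
  interpret nonsingleton_boolean S
    by unfold_locales (fact assms)+
  have "\<not> is_singleton (cohomology TYPE('k) (NS S) n) \<longleftrightarrow> n = card S - 1" for n
    using cohomology_NS(1)[of n, where 'k = 'k] cohomology_NS(3)[where 'k = 'k] by blast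
  moreover have "2 \<le> card S \<longrightarrow> cohomology_free_of_rank TYPE('k) (NS S) (card S - 1) (card S - 1)"
    using cohomology_NS(2)[where 'k = 'k] by auto
  moreover have "card S = 1 \<longrightarrow> cohomology_free_of_rank TYPE('k) (NS S) (card S - 1) 1"
    using cohomology_NS(2)[where 'k = 'k] by (intro impI) simp
  ultimately show ?thesis
    using geometric Cohen_Macaulay[where 'k = 'k] by blast
qed

end
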